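(* Let $\mathcal{C}$ be a small category with (weak) pullbacks and let $\hat{\mathcal{C}}=[\mathcal{C}^{op},\mathsf{Set}]$. For every internal join-semilattice $L$ in $\hat{\mathcal{C}}$ (equivalently, a functor $L$ from $\mathcal{C}^{op}$ to join-semilattices), the internal object of ideals $\mathrm{idl}_{\hat{\mathcal{C}}}L$ is given by $\mathfrak{z}(\mathrm{idl}\circ L)\in\mathsf{Frm}[\mathcal{C}^{op},\mathsf{Set}]$; that is, it is given by $\mathfrak{z}(\mathrm{idl}\circ L)$, which is an internal frame in $\hat{\mathcal{C}}$.
   Context: For an arrow $f$ of $\mathcal{C}$, $\vartheta_0 f$ is its source and $\vartheta_1 f$ its target. Join-semilattices have a least element $0$ and binary joins, and their morphisms preserve these. An ideal of a join-semilattice $K$ is a subset $I\subseteq K$ containing $0$, downward closed, and closed under binary joins; $\mathrm{idl}\,K$ is the poset of ideals ordered by inclusion. A morphism $h\colon K\to K'$ induces $\mathrm{idl}\,K\to\mathrm{idl}\,K'$ sending $I$ to $h[I]$, the ideal generated by the set-theoretic direct image of $I$; $\mathrm{idl}\circ L$ is the resulting presheaf $a\mapsto \mathrm{idl}(La)$ on $\mathcal{C}$. The internal object of ideals $\mathrm{idl}_{\hat{\mathcal{C}}}L$ is the object of ideals of $L$ formed in the internal logic of the topos $\hat{\mathcal{C}}$, ordered by inclusion. "Given by" means isomorphic to. $\mathsf{SupLat}$ is the category of complete lattices and maps preserving arbitrary suprema. A frame is a complete lattice in which $u\wedge\bigvee_i v_i=\bigvee_i(u\wedge v_i)$ always holds;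 frame homomorphisms preserve finite infima and arbitrary suprema; $\mathsf{Frm}$ is the category of frames and frame homomorphisms. $\mathsf{Frm}[\mathcal{C}^{op},\mathsf{Set}]$ is the category of internal frames in $[\mathcal{C}^{op},\mathsf{Set}]$. An internal frame is (described as) a functor $M\colon\mathcal{C}^{op}\to\mathsf{Frm}$ such that each $Mf\colon Ma\to Mb$ (for $f\colon b\to a$) has a left adjoint $\Sigma_f\colon Mb\to Ma$, the Beck-Chevalley condition $Ms\circ\Sigma_r=\Sigma_q\circ Mp$ holds for every (weak) pullback square $rp=sq$ in $\mathcal{C}$, and Frobenius reciprocity $\Sigma_f(Mf(u)\wedge v)=u\wedge\Sigma_f v$ holds for all $u\in Ma$, $v\in Mb$. Morphisms of internal frames are natural transformations whose components are frame homomorphisms and which commute with the maps $\Sigma_f$. For a presheaf $M$ on $\mathcal{C}$ with values in $\mathsf{SupLat}$ (in particular, with values in $\mathsf{Frm}$), $\mathfrak{z}M$ is defined by $$\mathfrak{z}M(a)=\Big\{(u_f)_{\vartheta_1 f=a}\in\prod_{\vartheta_1 f=a}M(\vartheta_0 f)\ \Big|\ M(g)(u_f)\le u_{fg}\text{ for all } f, g \text{ with } \vartheta_1 f=a,\ \vartheta_1 g=\vartheta_0 f\Big\},$$ ordered componentwise, with, for $r\colon b\to a$, $\mathfrak{z}M(r)\big((u_f)_{\vartheta_1 f=a}\big)=(u_{rh})_{\vartheta_1 h=b}$, and with left adjoint to $\mathfrak{z}M(r)$ given by $\Sigma^{\mathfrak{z}M}_r (u_f)_{\vartheta_1 f=b}=\big(\bigvee_{rf=g}u_f\big)_{\vartheta_1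 g=a}$.
   Formalization: That z(idl∘L) is an internal frame is shown only when every join-semilattice L(a) is distributive (it fails for C terminal, L = M3); for arbitrary L the isomorphism with the object of ideals and an internal sup-lattice structure are shown. *)

theory Defs
  imports "HOL-Algebra.Galois_Connection" "HOL-Library.FuncSet"
begin

section \<open>Small categories\<close>

record ('o, 'm) cat =
  Obj :: "'o set"
  Arr :: "'m set"
  src :: "'m \<Rightarrow> 'o"
  tgt :: "'m \<Rightarrow> 'o"
  idn :: "'o \<Rightarrow> 'm"
  cmp :: "'m \<Rightarrow> 'm \<Rightarrow> 'm"  (infixl \<open>\<cdot>\<index>\<close> 75)

definition into :: "('o, 'm) cat \<Rightarrow> 'o \<Rightarrow> 'm set" where
  "into C a = {f \<in> Arr C. tgt C f = a}"

text \<open>\<open>f \<cdot> g\<close> is ``first \<open>g\<close>, then \<open>f\<close>'', meaningful for \<open>tgt g = src f\<close>.\<close>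

locale small_category =
  fixes C :: "('o, 'm) cat" (structure)
  assumes src_closed: "f \<in> Arr C \<Longrightarrow> src C f \<in> Obj C"
    and tgt_closed: "f \<in> Arr C \<Longrightarrow> tgt C f \<in> Obj C"
    and idn_arr: "a \<in> Obj C \<Longrightarrow> idn C a \<in> Arr C \<and> src C (idn C a) = a \<and> tgt C (idn C a) = a"
    and cmp_arr: "\<lbrakk>f \<in> Arr C; g \<in> Arr C; tgt C g = src C f\<rbrakk>
        \<Longrightarrow> f \<cdot> g \<in> Arr C \<and> src C (f \<cdot> g) = src C g \<and> tgt C (f \<cdot> g) = tgt C f"
    and idn_left: "f \<in> Arr C \<Longrightarrow> idn C (tgt C f) \<cdot> f = f"
    and idn_right: "f \<in> Arr C \<Longrightarrow> f \<cdot> idn C (src C f) = f"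
    and cmp_assoc: "\<lbrakk>f \<in> Arr C; g \<in> Arr C; h \<in> Arr C; tgt C g = src C f; tgt C h = src C g\<rbrakk>
        \<Longrightarrow> (f \<cdot> g) \<cdot> h = f \<cdot> (g \<cdot> h)"

text \<open>The square \<open>r \<cdot> p = s \<cdot> q\<close> is a weak pullback: factorizations exist but need not be unique,
  so every pullback is a weak pullback.\<close>

definition weak_pullback :: "('o, 'm) cat \<Rightarrow> 'm \<Rightarrow> 'm \<Rightarrow> 'm \<Rightarrow> 'm \<Rightarrow> bool" where
  "weak_pullback C r p s q \<longleftrightarrow>
     {r, p, s, q} \<subseteq> Arr C \<and> tgt C r = tgt C s \<and> tgt C p = src C r \<and> tgt C q = src C s \<and>
     src C p = src C q \<and> r \<cdot>\<^bsub>C\<^esub> p = s \<cdot>\<^bsub>C\<^esub> q \<and>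
     (\<forall>f \<in> into C (src C r). \<forall>g \<in> into C (src C s).
        src C f = src C g \<and> r \<cdot>\<^bsub>C\<^esub> f = s \<cdot>\<^bsub>C\<^esub> g \<longrightarrow>
        (\<exists>h \<in> into C (src C p). p \<cdot>\<^bsub>C\<^esub> h = f \<and> q \<cdot>\<^bsub>C\<^esub> h = g))"

definition has_weak_pullbacks :: "('o, 'm) cat \<Rightarrow> bool" where
  "has_weak_pullbacks C \<longleftrightarrow>
     (\<forall>r \<in> Arr C. \<forall>s \<in> Arr C. tgt C r = tgt C s \<longrightarrow> (\<exists>p q. weak_pullback C r p s q))"


section \<open>Semilattices, ideals, frames\<close>

definition join_semilattice :: "'x gorder \<Rightarrow> bool" where
  "join_semilattice K \<longleftrightarrow> upper_semilattice K \<and> weak_partial_order_bottom K"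

definition jsl_hom :: "'x gorder \<Rightarrow> 'y gorder \<Rightarrow> ('x \<Rightarrow> 'y) \<Rightarrow> bool" where
  "jsl_hom K K' h \<longleftrightarrow> h \<in> carrier K \<rightarrow> carrier K' \<and> h \<bottom>\<^bsub>K\<^esub> = \<bottom>\<^bsub>K'\<^esub> \<and>
     (\<forall>x \<in> carrier K. \<forall>y \<in> carrier K. h (x \<squnion>\<^bsub>K\<^esub> y) = h x \<squnion>\<^bsub>K'\<^esub> h y)"

text \<open>Distributivity in the sense of join-semilattices; the lattice of ideals of \<open>K\<close> is a frame
  exactly when \<open>K\<close> has this property.\<close>

definition distributive_jsl :: "'x gorder \<Rightarrow> bool" where
  "distributive_jsl K \<longleftrightarrow>
     (\<forall>x \<in> carrier K. \<forall>y \<in> carrier K. \<forall>z \<in> carrier K. x \<sqsubseteq>\<^bsub>K\<^esub> y \<squnion>\<^bsub>K\<^esub> z \<longrightarrow>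
        (\<exists>y' \<in> carrier K. \<exists>z' \<in> carrier K. y' \<sqsubseteq>\<^bsub>K\<^esub> y \<and> z' \<sqsubseteq>\<^bsub>K\<^esub> z \<and> x = y' \<squnion>\<^bsub>K\<^esub> z'))"

definition jsl_ideal :: "'x gorder \<Rightarrow> 'x set \<Rightarrow> bool" where
  "jsl_ideal K I \<longleftrightarrow> I \<subseteq> carrier K \<and> \<bottom>\<^bsub>K\<^esub> \<in> I \<and>
     (\<forall>x \<in> carrier K. \<forall>y \<in> I. x \<sqsubseteq>\<^bsub>K\<^esub> y \<longrightarrow> x \<in> I) \<and>
     (\<forall>x \<in> I. \<forall>y \<in> I. x \<squnion>\<^bsub>K\<^esub> y \<in> I)"

definition idl :: "'x gorder \<Rightarrow> 'x set gorder" where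
  "idl K = \<lparr>carrier = {I. jsl_ideal K I}, eq = (=), le = (\<subseteq>)\<rparr>"

definition ideal_generated :: "'x gorder \<Rightarrow> 'x set \<Rightarrow> 'x set" where
  "ideal_generated K A = \<Inter>{J. jsl_ideal K J \<and> A \<subseteq> J}"

definition frame :: "'x gorder \<Rightarrow> bool" where
  "frame K \<longleftrightarrow> complete_lattice K \<and>
     (\<forall>u \<in> carrier K. \<forall>V \<subseteq> carrier K. u \<sqinter>\<^bsub>K\<^esub> (\<Squnion>\<^bsub>K\<^esub> V) = \<Squnion>\<^bsub>K\<^esub> ((\<lambda>v. u \<sqinter>\<^bsub>K\<^esub> v) ` V))"

definition suplat_hom :: "'x gorder \<Rightarrow> 'y gorder \<Rightarrow> ('x \<Rightarrow> 'y) \<Rightarrow> bool" where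
  "suplat_hom K K' h \<longleftrightarrow> h \<in> carrier K \<rightarrow> carrier K' \<and> sup_pres K K' h"

definition frame_hom :: "'x gorder \<Rightarrow> 'y gorder \<Rightarrow> ('x \<Rightarrow> 'y) \<Rightarrow> bool" where
  "frame_hom K K' h \<longleftrightarrow> h \<in> carrier K \<rightarrow> carrier K' \<and> sup_pres K K' h \<and>
     meet_pres K K' h \<and> h \<top>\<^bsub>K\<^esub> = \<top>\<^bsub>K'\<^esub>"


section \<open>Presheaves of ordered sets\<close>

text \<open>\<open>fib M a\<close> is \<open>M a\<close>; for \<open>f : b \<rightarrow> a\<close>, \<open>res M f\<close> is \<open>M f : M a \<rightarrow> M b\<close>.\<close>

record ('o, 'm, 'x) presheaf =
  fib :: "'o \<Rightarrow> 'x gorder"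
  res :: "'m \<Rightarrow> 'x \<Rightarrow> 'x"

definition is_presheaf :: "('o, 'm) cat \<Rightarrow> ('o, 'm, 'x) presheaf \<Rightarrow> bool" where
  "is_presheaf C M \<longleftrightarrow>
     (\<forall>f \<in> Arr C. res M f \<in> carrier (fib M (tgt C f)) \<rightarrow> carrier (fib M (src C f))) \<and>
     (\<forall>a \<in> Obj C. \<forall>x \<in> carrier (fib M a). res M (idn C a) x = x) \<and>
     (\<forall>f \<in> Arr C. \<forall>g \<in> into C (src C f). \<forall>x \<in> carrier (fib M (tgt C f)).
        res M (f \<cdot>\<^bsub>C\<^esub> g) x = res M g (res M f x))"

definition jsl_presheaf :: "('o, 'm) cat \<Rightarrow> ('o, 'm, 'x) presheaf \<Rightarrow> bool" where
  "jsl_presheaf C L \<longleftrightarrow> is_presheaf C L \<and>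
     (\<forall>a \<in> Obj C. join_semilattice (fib L a)) \<and>
     (\<forall>f \<in> Arr C. jsl_hom (fib L (tgt C f)) (fib L (src C f)) (res L f))"

text \<open>Isomorphism of internal posets: natural in the stage, an order isomorphism at each stage.\<close>

definition presheaf_iso ::
    "('o, 'm) cat \<Rightarrow> ('o, 'm, 'x) presheaf \<Rightarrow> ('o, 'm, 'y) presheaf \<Rightarrow> bool" where
  "presheaf_iso C M N \<longleftrightarrow> is_presheaf C M \<and> is_presheaf C N \<and>
     (\<exists>\<phi>. (\<forall>a \<in> Obj C. bij_betw (\<phi> a) (carrier (fib M a)) (carrier (fib N a)) \<and>
                        order_emb (fib M a) (fib N a) (\<phi> a)) \<and>
          (\<forall>f \<in> Arr C. \<forall>x \<in> carrier (fib M (tgt C f)).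
             \<phi> (src C f) (res M f x) = res N f (\<phi> (tgt C f) x)))"

definition left_adjoints ::
    "('o, 'm) cat \<Rightarrow> ('o, 'm, 'x) presheaf \<Rightarrow> ('m \<Rightarrow> 'x \<Rightarrow> 'x) \<Rightarrow> bool" where
  "left_adjoints C M \<Sigma> \<longleftrightarrow>
     (\<forall>f \<in> Arr C. galois_connection
        \<lparr>orderA = fib M (src C f), orderB = fib M (tgt C f), lower = \<Sigma> f, upper = res M f\<rparr>)"

definition beck_chevalley ::
    "('o, 'm) cat \<Rightarrow> ('o, 'm, 'x) presheaf \<Rightarrow> ('m \<Rightarrow> 'x \<Rightarrow> 'x) \<Rightarrow> bool" where
  "beck_chevalley C M \<Sigma> \<longleftrightarrow>
     (\<forall>r p s q. weak_pullback C r p s q \<longrightarrow>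
        (\<forall>u \<in> carrier (fib M (src C r)). res M s (\<Sigma> r u) = \<Sigma> q (res M p u)))"

definition frobenius ::
    "('o, 'm) cat \<Rightarrow> ('o, 'm, 'x) presheaf \<Rightarrow> ('m \<Rightarrow> 'x \<Rightarrow> 'x) \<Rightarrow> bool" where
  "frobenius C M \<Sigma> \<longleftrightarrow>
     (\<forall>f \<in> Arr C. \<forall>u \<in> carrier (fib M (tgt C f)). \<forall>v \<in> carrier (fib M (src C f)).
        \<Sigma> f (res M f u \<sqinter>\<^bsub>fib M (src C f)\<^esub> v) = u \<sqinter>\<^bsub>fib M (tgt C f)\<^esub> \<Sigma> f v)"

definition internal_suplattice ::
    "('o, 'm) cat \<Rightarrow> ('o, 'm, 'x) presheaf \<Rightarrow> ('m \<Rightarrow> 'x \<Rightarrow> 'x) \<Rightarrow> bool" where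
  "internal_suplattice C M \<Sigma> \<longleftrightarrow> is_presheaf C M \<and>
     (\<forall>a \<in> Obj C. complete_lattice (fib M a)) \<and>
     (\<forall>f \<in> Arr C. suplat_hom (fib M (tgt C f)) (fib M (src C f)) (res M f)) \<and>
     left_adjoints C M \<Sigma> \<and> beck_chevalley C M \<Sigma>"

definition internal_frame ::
    "('o, 'm) cat \<Rightarrow> ('o, 'm, 'x) presheaf \<Rightarrow> ('m \<Rightarrow> 'x \<Rightarrow> 'x) \<Rightarrow> bool" where
  "internal_frame C M \<Sigma> \<longleftrightarrow> is_presheaf C M \<and>
     (\<forall>a \<in> Obj C. frame (fib M a)) \<and>
     (\<forall>f \<in> Arr C. frame_hom (fib M (tgt C f)) (fib M (src C f)) (res M f)) \<and>
     left_adjoints C M \<Sigma> \<and> beck_chevalley C M \<Sigma> \<and> frobenius C M \<Sigma>"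

definition idl_presheaf :: "('o, 'm) cat \<Rightarrow> ('o, 'm, 'x) presheaf \<Rightarrow> ('o, 'm, 'x set) presheaf" where
  "idl_presheaf C L = \<lparr>fib = (\<lambda>a. idl (fib L a)),
     res = (\<lambda>f I. ideal_generated (fib L (src C f)) (res L f ` I))\<rparr>"


section \<open>The construction \<open>zed\<close>\<close>

text \<open>Families \<open>(u\<^sub>f)\<close> indexed by the arrows \<open>f\<close> with target \<open>a\<close> are extensional functions
  on \<open>into C a\<close>.\<close>

definition zed :: "('o, 'm) cat \<Rightarrow> ('o, 'm, 'x) presheaf \<Rightarrow> ('o, 'm, 'm \<Rightarrow> 'x) presheaf" where
  "zed C M = \<lparr>
     fib = (\<lambda>a. \<lparr>
       carrier = {u \<in> (\<Pi>\<^sub>E f \<in> into C a. carrier (fib M (src C f))).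
          \<forall>f \<in> into C a. \<forall>g \<in> into C (src C f).
            res M g (u f) \<sqsubseteq>\<^bsub>fib M (src C g)\<^esub> u (f \<cdot>\<^bsub>C\<^esub> g)},
       eq = (=),
       le = (\<lambda>u v. \<forall>f \<in> into C a. u f \<sqsubseteq>\<^bsub>fib M (src C f)\<^esub> v f)\<rparr>),
     res = (\<lambda>r u. \<lambda>h \<in> into C (src C r). u (r \<cdot>\<^bsub>C\<^esub> h))\<rparr>"

definition zed_sigma ::
    "('o, 'm) cat \<Rightarrow> ('o, 'm, 'x) presheaf \<Rightarrow> 'm \<Rightarrow> ('m \<Rightarrow> 'x) \<Rightarrow> 'm \<Rightarrow> 'x" where
  "zed_sigma C M r u = (\<lambda>g \<in> into C (tgt C r).
     \<Squnion>\<^bsub>fib M (src C g)\<^esub> {u f | f. f \<in> into C (src C r) \<and> r \<cdot>\<^bsub>C\<^esub> f = g})"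


section \<open>The internal object of ideals\<close>

text \<open>The power object of \<open>L\<close> in the presheaf topos: its elements at stage \<open>a\<close> are the
  sub-presheaves of \<open>y\<^sub>a \<times> L\<close>, where \<open>y\<^sub>a\<close> is the presheaf represented by \<open>a\<close>; restriction along
  \<open>r : b \<rightarrow> a\<close> is pullback along \<open>y\<^sub>r \<times> L\<close>.\<close>

definition subpresheaves :: "('o, 'm) cat \<Rightarrow> ('o, 'm, 'x) presheaf \<Rightarrow> 'o \<Rightarrow> ('m \<times> 'x) set set" where
  "subpresheaves C L a =
     {S. S \<subseteq> (SIGMA f : into C a. carrier (fib L (src C f))) \<and>
         (\<forall>(f, x) \<in> S. \<forall>g \<in> into C (src C f). (f \<cdot>\<^bsub>C\<^esub> g, res L g x) \<in> S)}"

definition pow_res ::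
    "('o, 'm) cat \<Rightarrow> ('o, 'm, 'x) presheaf \<Rightarrow> 'm \<Rightarrow> ('m \<times> 'x) set \<Rightarrow> ('m \<times> 'x) set" where
  "pow_res C L r S =
     {(h, x) \<in> (SIGMA h : into C (src C r). carrier (fib L (src C h))). (r \<cdot>\<^bsub>C\<^esub> h, x) \<in> S}"

text \<open>The fragment of the internal language in which being an ideal is expressed: terms of sort
  \<open>L\<close> over named variables, and formulas with one further free variable \<open>I\<close>, of sort the power
  object of \<open>L\<close>; \<open>Mem t\<close> stands for \<open>t \<in> I\<close>. Formulas are interpreted by the Kripke-Joyal
  semantics of the presheaf topos.\<close>

datatype jsl_term = Var nat | Bot | Join jsl_term jsl_term

datatype jsl_form = Le jsl_term jsl_term | Mem jsl_term
  | And jsl_form jsl_form | Imp jsl_form jsl_form | All nat jsl_form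

primrec term_val :: "'x gorder \<Rightarrow> (nat \<Rightarrow> 'x) \<Rightarrow> jsl_term \<Rightarrow> 'x" where
  "term_val K e (Var n) = e n"
| "term_val K e Bot = \<bottom>\<^bsub>K\<^esub>"
| "term_val K e (Join s t) = term_val K e s \<squnion>\<^bsub>K\<^esub> term_val K e t"

primrec forces :: "('o, 'm) cat \<Rightarrow> ('o, 'm, 'x) presheaf \<Rightarrow> jsl_form \<Rightarrow>
    'o \<Rightarrow> ('m \<times> 'x) set \<Rightarrow> (nat \<Rightarrow> 'x) \<Rightarrow> bool" where
  "forces C L (Le s t) a I e \<longleftrightarrow>
     term_val (fib L a) e s \<sqsubseteq>\<^bsub>fib L a\<^esub> term_val (fib L a) e t"
| "forces C L (Mem t) a I e \<longleftrightarrow> (idn C a, term_val (fib L a) e t) \<in> I"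
| "forces C L (And A B) a I e \<longleftrightarrow> forces C L A a I e \<and> forces C L B a I e"
| "forces C L (Imp A B) a I e \<longleftrightarrow>
     (\<forall>g \<in> into C a.
        forces C L A (src C g) (pow_res C L g I) (\<lambda>n. res L g (e n)) \<longrightarrow>
        forces C L B (src C g) (pow_res C L g I) (\<lambda>n. res L g (e n)))"
| "forces C L (All n A) a I e \<longleftrightarrow>
     (\<forall>g \<in> into C a. \<forall>x \<in> carrier (fib L (src C g)).
        forces C L A (src C g) (pow_res C L g I) ((\<lambda>m. res L g (e m))(n := x)))"

definition ideal_form :: jsl_form where
  "ideal_form =
     And (Mem Bot)
    (And (All 0 (All 1 (Imp (And (Le (Var 0) (Var 1)) (Mem (Var 1))) (Mem (Var 0)))))
         (All 0 (All 1 (Imp (And (Mem (Var 0)) (Mem (Var 1))) (Mem (Join (Var 0) (Var 1)))))))"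

text \<open>The subobject of the power object cut out by \<open>ideal_form\<close>. The formula has no free variable
  of sort \<open>L\<close>, so the choice of environment is immaterial.\<close>

definition internal_idl ::
    "('o, 'm) cat \<Rightarrow> ('o, 'm, 'x) presheaf \<Rightarrow> ('o, 'm, ('m \<times> 'x) set) presheaf" where
  "internal_idl C L = \<lparr>
     fib = (\<lambda>a. \<lparr>
       carrier = {I \<in> subpresheaves C L a. forces C L ideal_form a I (\<lambda>_. \<bottom>\<^bsub>fib L a\<^esub>)},
       eq = (=),
       le = (\<subseteq>)\<rparr>),
     res = pow_res C L\<rparr>"

end

theory Submission
  imports Defs
begin

text \<open>
  A sub-presheaf \<open>I\<close> of \<open>y\<^sub>a \<times> L\<close> is the same thing as the family of its slices
  \<open>I\<^sub>f = {x. (f, x) \<in> I}\<close>, one subset of \<open>L (src f)\<close> for each arrow \<open>f\<close> into \<open>a\<close>, subject to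
  \<open>L g [I\<^sub>f] \<subseteq> I\<^sub>f\<^sub>g\<close>. All quantifiers in the formula \<open>ideal_form\<close> range over the stages above the
  current one, so unwinding the forcing relation shows that \<open>I\<close> is forced to be an ideal exactly when
  every slice is an ordinary ideal (\<open>forces_ideal_form_iff\<close>). For ideals, the displayed condition says
  that the ideal generated by \<open>L g [I\<^sub>f]\<close> lies in \<open>I\<^sub>f\<^sub>g\<close>, and this is the compatibility condition
  defining \<open>zed\<close> of the presheaf of ideals. Passing from \<open>I\<close> to its slices is therefore an order
  isomorphism at each stage, and it is natural because restriction reindexes on both sides.

  The structure on \<open>zed M\<close> is pointwise and is obtained for any presheaf \<open>M\<close> of complete lattices and
  supremum-preserving maps. Suprema of compatible families are pointwise because the maps \<open>M g\<close>
  preserve suprema, infima are pointwise because these maps are monotone, and restriction along an arrow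
  is reindexing, which commutes with both. The left adjoint \<open>\<Sigma>\<^sub>r\<close> takes suprema over the
  factorizations of an arrow through \<open>r\<close>. For Beck-Chevalley, a weak pullback square matches the
  factorizations on one side with those on the other. If the fibres are frames, distributivity
  and Frobenius reciprocity are the frame law in single fibres.

  It remains to see that ideals form such a presheaf. Taking the ideal generated by a direct image is
  left adjoint to the preimage of ideals, so it preserves suprema; and the ideals of a distributive
  join-semilattice form a frame (\<open>frame_idl\<close>).
\<close>


section \<open>Suprema and infima from universal properties\<close>

context partial_order
begin

lemma sup_eqI: "is_lub L s A \<Longrightarrow> \<Squnion>A = s"
  unfolding Lattice.sup_def by (rule some_equality) (auto intro: least_unique)

lemma inf_eqI: "is_glb L i A \<Longrightarrow> \<Sqinter>A = i"
  unfolding Lattice.inf_def by (rule some_equality) (auto intro: greatest_unique)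

lemma top_eqI: "greatest L t (carrier L) \<Longrightarrow> \<top> = t"
  unfolding Order.top_def by (rule some_equality) (auto intro: greatest_unique)

end


section \<open>The lattice of ideals of a join-semilattice\<close>

locale jsl = upper_semilattice K + weak_partial_order_bottom K for K :: "'x gorder" (structure)

lemma jsl_if_join_semilattice: "join_semilattice K \<Longrightarrow> jsl K"
  by (simp add: join_semilattice_def jsl_def)

lemma carrier_idl [simp]: "I \<in> carrier (idl K) \<longleftrightarrow> jsl_ideal K I"
  by (simp add: idl_def)

lemma le_idl [simp]: "I \<sqsubseteq>\<^bsub>idl K\<^esub> J \<longleftrightarrow> I \<subseteq> J"
  by (simp add: idl_def)

lemma partial_order_idl: "partial_order (idl K)"
  by unfold_locales (auto simp: idl_def)

lemma jsl_ideal_subset: "jsl_ideal K I \<Longrightarrow> I \<subseteq> carrier K"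
  by (simp add: jsl_ideal_def)

lemma Union_ideals_subset: "V \<subseteq> carrier (idl K) \<Longrightarrow> \<Union>V \<subseteq> carrier K"
  by (rule Union_least) (use jsl_ideal_subset carrier_idl in blast)

lemma ideal_generated_superset: "A \<subseteq> ideal_generated K A"
  by (auto simp: ideal_generated_def)

lemma ideal_generated_le_iff:
  assumes "jsl_ideal K J"
  shows "ideal_generated K A \<subseteq> J \<longleftrightarrow> A \<subseteq> J"
  using assms ideal_generated_superset[of A K] unfolding ideal_generated_def by blast

lemma ideal_generated_ideal_eq: "jsl_ideal K I \<Longrightarrow> ideal_generated K I = I"
  by (simp add: ideal_generated_le_iff ideal_generated_superset subset_antisym)

context jsl
begin

lemma jsl_ideal_Inter:
  assumes "\<And>I. I \<in> V \<Longrightarrow> jsl_ideal K I"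
  shows "jsl_ideal K (carrier K \<inter> \<Inter>V)"
  unfolding jsl_ideal_def
proof (intro conjI ballI impI)
  show "x \<in> carrier K \<inter> \<Inter>V" if "x \<in> carrier K" "y \<in> carrier K \<inter> \<Inter>V" "x \<sqsubseteq> y" for x y
    using that assms unfolding jsl_ideal_def by blast
qed (use assms in \<open>auto simp: jsl_ideal_def\<close>)

lemma jsl_ideal_generated:
  assumes "A \<subseteq> carrier K"
  shows "jsl_ideal K (ideal_generated K A)"
proof -
  have "jsl_ideal K (carrier K)"
    by (simp add: jsl_ideal_def)
  with assms have "ideal_generated K A = carrier K \<inter> \<Inter>{J. jsl_ideal K J \<and> A \<subseteq> J}"
    unfolding ideal_generated_def by auto
  then show ?thesis
    using jsl_ideal_Inter[of "{J. jsl_ideal K J \<and> A \<subseteq> J}"] by simp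
qed

lemma idl_lub:
  assumes "V \<subseteq> carrier (idl K)"
  shows "is_lub (idl K) (ideal_generated K (\<Union>V)) V"
proof (rule least_UpperI)
  have "\<Union>V \<subseteq> carrier K"
    using assms by (rule Union_ideals_subset)
  then show "ideal_generated K (\<Union>V) \<in> carrier (idl K)"
    by (simp add: jsl_ideal_generated)
  show "I \<sqsubseteq>\<^bsub>idl K\<^esub> ideal_generated K (\<Union>V)" if "I \<in> V" for I
    using that ideal_generated_superset[of "\<Union>V" K] by auto
  show "ideal_generated K (\<Union>V) \<sqsubseteq>\<^bsub>idl K\<^esub> J" if "J \<in> Upper (idl K) V" for J
  proof -
    have "jsl_ideal K J" "\<Union>V \<subseteq> J"
      using that assms by (fastforce simp: Upper_def)+
    then show ?thesis
      by (simp add: ideal_generated_le_iff)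
  qed
qed (fact assms)

lemma idl_glb:
  assumes "V \<subseteq> carrier (idl K)"
  shows "is_glb (idl K) (carrier K \<inter> \<Inter>V) V"
proof (rule greatest_LowerI)
  show "carrier K \<inter> \<Inter>V \<in> carrier (idl K)"
    unfolding carrier_idl using assms by (intro jsl_ideal_Inter) auto
  show "J \<sqsubseteq>\<^bsub>idl K\<^esub> carrier K \<inter> \<Inter>V" if "J \<in> Lower (idl K) V" for J
    using that assms jsl_ideal_subset by (fastforce simp: Lower_def)
qed (use assms in auto)

lemma complete_lattice_idl: "complete_lattice (idl K)"
  using partial_order.complete_latticeI[OF partial_order_idl] idl_lub idl_glb by blast

lemma sup_idl: "V \<subseteq> carrier (idl K) \<Longrightarrow> \<Squnion>\<^bsub>idl K\<^esub> V = ideal_generated K (\<Union>V)"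
  by (rule partial_order.sup_eqI[OF partial_order_idl idl_lub])

lemma meet_idl:
  assumes "jsl_ideal K I" "jsl_ideal K J"
  shows "I \<sqinter>\<^bsub>idl K\<^esub> J = I \<inter> J"
proof -
  have "I \<sqinter>\<^bsub>idl K\<^esub> J = carrier K \<inter> \<Inter>{I, J}"
    unfolding meet_def
    by (rule partial_order.inf_eqI[OF partial_order_idl], rule idl_glb) (simp add: assms)
  then show ?thesis
    using jsl_ideal_subset[OF assms(1)] by auto
qed

text \<open>An element of \<open>I\<close> below a join of generators splits, by distributivity, into pieces below
  the single generators. Rather than handle finite joins of generators, fix \<open>J\<close>, the ideal
  generated by the \<open>I \<inter> v\<close>: the elements \<open>x\<close> all of whose lower bounds in \<open>I\<close> belong to \<open>J\<close>
  form an ideal \<open>I \<Rightarrow> J\<close> (the Heyting implication), and it contains every \<open>v\<close>.\<close>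

lemma frame_idl:
  assumes distr: "distributive_jsl K"
  shows "frame (idl K)"
  unfolding frame_def
proof (intro conjI ballI allI impI)
  show "complete_lattice (idl K)" by (rule complete_lattice_idl)
  fix I V
  assume I: "I \<in> carrier (idl K)" and V: "V \<subseteq> carrier (idl K)"
  then have idl_I: "jsl_ideal K I" and idl_V: "\<And>v. v \<in> V \<Longrightarrow> jsl_ideal K v"
    by auto
  have UV: "\<Union>V \<subseteq> carrier K"
    using V by (rule Union_ideals_subset)
  define J where "J = ideal_generated K (\<Union>v\<in>V. I \<inter> v)"
  have idl_J: "jsl_ideal K J"
    unfolding J_def using UV by (intro jsl_ideal_generated) auto
  define W where "W = {x \<in> carrier K. \<forall>y \<in> I. y \<sqsubseteq> x \<longrightarrow> y \<in> J}"
  have idl_W: "jsl_ideal K W"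
    unfolding jsl_ideal_def
  proof (intro conjI ballI impI)
    show "W \<subseteq> carrier K" by (auto simp: W_def)
    have "y = \<bottom>" if "y \<in> I" "y \<sqsubseteq> \<bottom>" for y
      using that idl_I jsl_ideal_subset by blast
    then show "\<bottom> \<in> W"
      using idl_J by (auto simp: W_def jsl_ideal_def)
  next
    fix x y assume "x \<in> carrier K" "y \<in> W" "x \<sqsubseteq> y"
    then show "x \<in> W"
      using jsl_ideal_subset[OF idl_I] le_trans unfolding W_def by blast
  next
    fix x y assume x: "x \<in> W" and y: "y \<in> W"
    have "z \<in> J" if z: "z \<in> I" "z \<sqsubseteq> x \<squnion> y" for z
    proof -
      have carr: "x \<in> carrier K" "y \<in> carrier K" "z \<in> carrier K"
        using x y z jsl_ideal_subset[OF idl_I] by (auto simp: W_def)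
      then obtain x' y' where xy': "x' \<in> carrier K" "y' \<in> carrier K" "x' \<sqsubseteq> x" "y' \<sqsubseteq> y"
        and z_eq: "z = x' \<squnion> y'"
        using distr z(2) unfolding distributive_jsl_def by blast
      then have "x' \<in> I" "y' \<in> I"
        using idl_I z(1) join_left[of x' y'] join_right[of x' y'] unfolding jsl_ideal_def by auto
      then have "x' \<in> J" "y' \<in> J"
        using x y xy' by (auto simp: W_def)
      then show ?thesis
        using idl_J z_eq by (auto simp: jsl_ideal_def)
    qed
    then show "x \<squnion> y \<in> W"
      using x y by (auto simp: W_def)
  qed
  have "\<Union>V \<subseteq> W"
  proof
    fix x assume "x \<in> \<Union>V"
    then obtain v where v: "v \<in> V" "x \<in> v" by blast
    have "y \<in> J" if "y \<in> I" "y \<sqsubseteq> x" for y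
    proof -
      have "y \<in> v"
        using that v idl_V[OF v(1)] jsl_ideal_subset[OF idl_I] unfolding jsl_ideal_def by blast
      then show ?thesis
        unfolding J_def using ideal_generated_superset that(1) v(1) by fastforce
    qed
    then show "x \<in> W"
      using UV v by (auto simp: W_def)
  qed
  then have "I \<inter> ideal_generated K (\<Union>V) \<subseteq> J"
    using ideal_generated_le_iff[OF idl_W, of "\<Union>V"] jsl_ideal_subset[OF idl_I]
    unfolding W_def by blast
  moreover have "J \<subseteq> I \<inter> ideal_generated K (\<Union>V)"
  proof -
    have "jsl_ideal K (ideal_generated K (\<Union>V))"
      using UV by (rule jsl_ideal_generated)
    then show ?thesis
      unfolding J_def using ideal_generated_superset[of "\<Union>V" K]
      by (auto simp: ideal_generated_le_iff idl_I)
  qed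
  ultimately have eq: "I \<inter> ideal_generated K (\<Union>V) = J" by blast
  have meets: "(\<lambda>v. I \<sqinter>\<^bsub>idl K\<^esub> v) ` V = (\<lambda>v. I \<inter> v) ` V"
    using idl_I idl_V by (auto simp: meet_idl)
  have "jsl_ideal K (I \<inter> v)" if "v \<in> V" for v
    using idl_I idl_V[OF that] unfolding jsl_ideal_def by auto
  then have "\<Squnion>\<^bsub>idl K\<^esub> ((\<lambda>v. I \<sqinter>\<^bsub>idl K\<^esub> v) ` V) = J"
    unfolding meets J_def by (subst sup_idl) auto
  moreover have "I \<sqinter>\<^bsub>idl K\<^esub> (\<Squnion>\<^bsub>idl K\<^esub> V) = I \<inter> ideal_generated K (\<Union>V)"
    using V UV idl_I by (simp add: sup_idl meet_idl jsl_ideal_generated)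
  ultimately show "I \<sqinter>\<^bsub>idl K\<^esub> (\<Squnion>\<^bsub>idl K\<^esub> V) = \<Squnion>\<^bsub>idl K\<^esub> ((\<lambda>v. I \<sqinter>\<^bsub>idl K\<^esub> v) ` V)"
    using eq by simp
qed

end

locale jsl_morphism = K: jsl K + K': jsl K' for K :: "'x gorder" and K' :: "'y gorder" +
  fixes h :: "'x \<Rightarrow> 'y"
  assumes hom: "jsl_hom K K' h"
begin

lemma hom_closed: "x \<in> carrier K \<Longrightarrow> h x \<in> carrier K'"
  using hom by (auto simp: jsl_hom_def)

lemma hom_mono:
  assumes "x \<in> carrier K" "y \<in> carrier K" "x \<sqsubseteq>\<^bsub>K\<^esub> y"
  shows "h x \<sqsubseteq>\<^bsub>K'\<^esub> h y"
proof -
  have "x \<squnion>\<^bsub>K\<^esub> y = y"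
    using assms by (intro K.le_antisym K.join_le K.join_right) auto
  then have "h x \<squnion>\<^bsub>K'\<^esub> h y = h y"
    using hom assms by (metis jsl_hom_def)
  then show ?thesis
    using K'.join_left[of "h x" "h y"] assms hom_closed by simp
qed

lemma image_carrier: "A \<subseteq> carrier K \<Longrightarrow> h ` A \<subseteq> carrier K'"
  using hom_closed by blast

lemma preimage_ideal:
  assumes "jsl_ideal K' J"
  shows "jsl_ideal K {x \<in> carrier K. h x \<in> J}"
  unfolding jsl_ideal_def
proof (intro conjI ballI impI)
  show "x \<in> {x \<in> carrier K. h x \<in> J}"
    if "x \<in> carrier K" "y \<in> {x \<in> carrier K. h x \<in> J}" "x \<sqsubseteq>\<^bsub>K\<^esub> y" for x y
    using that assms hom_closed hom_mono unfolding jsl_ideal_def by blast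
qed (use assms hom in \<open>auto simp: jsl_ideal_def jsl_hom_def\<close>)

text \<open>This adjunction between direct image and preimage is what makes the direct image preserve
  suprema: a supremum of ideals is the ideal generated by their union.\<close>

lemma image_generated_le_iff:
  assumes "A \<subseteq> carrier K" "jsl_ideal K' J"
  shows "ideal_generated K' (h ` ideal_generated K A) \<subseteq> J \<longleftrightarrow> h ` A \<subseteq> J"
proof -
  have "h ` ideal_generated K A \<subseteq> J \<longleftrightarrow> ideal_generated K A \<subseteq> {x \<in> carrier K. h x \<in> J}"
    using jsl_ideal_subset[OF K.jsl_ideal_generated[OF assms(1)]] by blast
  also have "\<dots> \<longleftrightarrow> h ` A \<subseteq> J"
    using ideal_generated_le_iff[OF preimage_ideal[OF assms(2)]] assms(1) by auto
  finally show ?thesis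
    by (simp add: ideal_generated_le_iff assms(2))
qed

lemma image_generated:
  assumes "A \<subseteq> carrier K"
  shows "ideal_generated K' (h ` ideal_generated K A) = ideal_generated K' (h ` A)"
proof (rule subset_antisym)
  have "jsl_ideal K' (ideal_generated K' (h ` A))"
    using assms by (intro K'.jsl_ideal_generated image_carrier)
  then show "ideal_generated K' (h ` ideal_generated K A) \<subseteq> ideal_generated K' (h ` A)"
    by (simp add: image_generated_le_iff assms ideal_generated_superset)
  have idl: "jsl_ideal K' (ideal_generated K' (h ` ideal_generated K A))"
    by (rule K'.jsl_ideal_generated[OF image_carrier[OF jsl_ideal_subset[OF K.jsl_ideal_generated[OF assms]]]])
  then show "ideal_generated K' (h ` A) \<subseteq> ideal_generated K' (h ` ideal_generated K A)"
    using image_generated_le_iff[OF assms idl] by (simp add: ideal_generated_le_iff)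
qed

lemma suplat_hom_direct_image: "suplat_hom (idl K) (idl K') (\<lambda>I. ideal_generated K' (h ` I))"
  unfolding suplat_hom_def sup_pres_def
proof (intro conjI allI impI)
  show closed: "(\<lambda>I. ideal_generated K' (h ` I)) \<in> carrier (idl K) \<rightarrow> carrier (idl K')"
    by (simp add: K'.jsl_ideal_generated image_carrier jsl_ideal_subset)
  fix V assume V: "V \<subseteq> carrier (idl K)"
  then have UV: "\<Union>V \<subseteq> carrier K"
    by (rule Union_ideals_subset)
  let ?h = "\<lambda>I. ideal_generated K' (h ` I)"
  have hV: "?h ` V \<subseteq> carrier (idl K')"
    using closed V by blast
  then have Uh: "\<Union>(?h ` V) \<subseteq> carrier K'"
    by (rule Union_ideals_subset)
  have idl: "jsl_ideal K' (ideal_generated K' (h ` \<Union>V))"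
    by (rule K'.jsl_ideal_generated[OF image_carrier[OF UV]])
  have idl': "jsl_ideal K' (ideal_generated K' (\<Union>(?h ` V)))"
    by (rule K'.jsl_ideal_generated[OF Uh])
  have "ideal_generated K' (h ` \<Union>V) = ideal_generated K' (\<Union>(?h ` V))"
  proof (rule subset_antisym)
    have "h ` I \<subseteq> ideal_generated K' (\<Union>(?h ` V))" if "I \<in> V" for I
      using that ideal_generated_superset[of "h ` I" K'] ideal_generated_superset[of "\<Union>(?h ` V)" K']
      by blast
    then show "ideal_generated K' (h ` \<Union>V) \<subseteq> ideal_generated K' (\<Union>(?h ` V))"
      unfolding ideal_generated_le_iff[OF idl'] by blast
    have "?h I \<subseteq> ideal_generated K' (h ` \<Union>V)" if "I \<in> V" for I
      unfolding ideal_generated_le_iff[OF idl]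
      using that ideal_generated_superset[of "h ` \<Union>V" K'] by blast
    then show "ideal_generated K' (\<Union>(?h ` V)) \<subseteq> ideal_generated K' (h ` \<Union>V)"
      by (rule ideal_generated_le_iff[OF idl, THEN iffD2, OF UN_least])
  qed
  then show "?h (\<Squnion>\<^bsub>idl K\<^esub> V) = \<Squnion>\<^bsub>idl K'\<^esub> (?h ` V)"
    by (simp only: K.sup_idl[OF V] K'.sup_idl[OF hV] image_generated[OF UV])
next
  show "complete_lattice (idl K)" by (rule K.complete_lattice_idl)
  show "complete_lattice (idl K')" by (rule K'.complete_lattice_idl)
qed

end


section \<open>Families of elements of a presheaf of complete lattices\<close>

context small_category
begin

lemma into_tgt: "f \<in> Arr C \<Longrightarrow> f \<in> into C (tgt C f)"
  by (simp add: into_def)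

lemma src_into: "f \<in> into C a \<Longrightarrow> src C f \<in> Obj C"
  by (simp add: into_def src_closed)

lemma idn_into:
  assumes "a \<in> Obj C"
  shows "idn C a \<in> into C a" "src C (idn C a) = a"
  using idn_arr[OF assms] by (auto simp: into_def)

lemma cmp_into:
  assumes "f \<in> into C a" "g \<in> into C (src C f)"
  shows "f \<cdot> g \<in> into C a" "src C (f \<cdot> g) = src C g"
  using assms cmp_arr[of f g] by (auto simp: into_def)

lemma cmp_arr_into:
  assumes "r \<in> Arr C" "h \<in> into C (src C r)"
  shows "r \<cdot> h \<in> into C (tgt C r)" "src C (r \<cdot> h) = src C h"
  using cmp_into[OF into_tgt] assms by auto

lemma assoc_into:
  assumes "f \<in> Arr C" "g \<in> into C (src C f)" "h \<in> into C (src C g)"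
  shows "(f \<cdot> g) \<cdot> h = f \<cdot> (g \<cdot> h)"
  using assms cmp_assoc by (simp add: into_def)

lemma cmp_idn_into:
  assumes "f \<in> into C a"
  shows "idn C a \<cdot> f = f" "f \<cdot> idn C (src C f) = f"
  using assms idn_left idn_right by (auto simp: into_def)

lemma into_arr: "f \<in> into C a \<Longrightarrow> f \<in> Arr C"
  by (simp add: into_def)

end

lemma carrier_zed:
  "u \<in> carrier (fib (zed C M) a) \<longleftrightarrow>
    u \<in> (\<Pi>\<^sub>E f \<in> into C a. carrier (fib M (src C f))) \<and>
    (\<forall>f \<in> into C a. \<forall>g \<in> into C (src C f). res M g (u f) \<sqsubseteq>\<^bsub>fib M (src C g)\<^esub> u (f \<cdot>\<^bsub>C\<^esub> g))"
  by (simp add: zed_def)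

lemma le_zed:
  "u \<sqsubseteq>\<^bsub>fib (zed C M) a\<^esub> v \<longleftrightarrow> (\<forall>f \<in> into C a. u f \<sqsubseteq>\<^bsub>fib M (src C f)\<^esub> v f)"
  by (simp add: zed_def)

lemma res_zed: "res (zed C M) r u = (\<lambda>h \<in> into C (src C r). u (r \<cdot>\<^bsub>C\<^esub> h))"
  by (simp add: zed_def)

lemma zed_value_closed:
  "u \<in> carrier (fib (zed C M) a) \<Longrightarrow> f \<in> into C a \<Longrightarrow> u f \<in> carrier (fib M (src C f))"
  by (auto simp: carrier_zed)

lemma zed_value_res:
  "u \<in> carrier (fib (zed C M) a) \<Longrightarrow> f \<in> into C a \<Longrightarrow> g \<in> into C (src C f) \<Longrightarrow>
    res M g (u f) \<sqsubseteq>\<^bsub>fib M (src C g)\<^esub> u (f \<cdot>\<^bsub>C\<^esub> g)"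
  by (simp add: carrier_zed)

lemma zed_eqI:
  assumes "u \<in> carrier (fib (zed C M) a)" "v \<in> carrier (fib (zed C M) a)"
    and "\<And>f. f \<in> into C a \<Longrightarrow> u f = v f"
  shows "u = v"
  using assms by (intro PiE_ext[of u "into C a" "\<lambda>f. carrier (fib M (src C f))" v])
    (auto simp: carrier_zed)

locale suplat_presheaf = small_category C for C :: "('o, 'm) cat" (structure) +
  fixes M :: "('o, 'm, 'x) presheaf"
  assumes presheaf: "is_presheaf C M"
    and complete: "a \<in> Obj C \<Longrightarrow> complete_lattice (fib M a)"
    and res_suplat_hom: "f \<in> Arr C \<Longrightarrow> suplat_hom (fib M (tgt C f)) (fib M (src C f)) (res M f)"
begin

lemma complete_at: "f \<in> into C a \<Longrightarrow> complete_lattice (fib M (src C f))"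
  by (simp add: complete src_into)

lemma sup_at_closed:
  assumes "f \<in> into C a" "A \<subseteq> carrier (fib M (src C f))"
  shows "\<Squnion>\<^bsub>fib M (src C f)\<^esub> A \<in> carrier (fib M (src C f))"
proof -
  interpret complete_lattice "fib M (src C f)"
    by (rule complete_at[OF assms(1)])
  show ?thesis
    by (rule sup_closed[OF assms(2)])
qed

lemma inf_at_closed:
  assumes "f \<in> into C a" "A \<subseteq> carrier (fib M (src C f))"
  shows "\<Sqinter>\<^bsub>fib M (src C f)\<^esub> A \<in> carrier (fib M (src C f))"
proof -
  interpret complete_lattice "fib M (src C f)"
    by (rule complete_at[OF assms(1)])
  show ?thesis
    by (rule inf_closed[OF assms(2)])
qed

lemma res_closed:
  "g \<in> into C b \<Longrightarrow> x \<in> carrier (fib M b) \<Longrightarrow> res M g x \<in> carrier (fib M (src C g))"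
  using res_suplat_hom[of g] by (auto simp: suplat_hom_def into_def)

lemma res_sup:
  "g \<in> into C b \<Longrightarrow> A \<subseteq> carrier (fib M b) \<Longrightarrow>
    res M g (\<Squnion>\<^bsub>fib M b\<^esub> A) = \<Squnion>\<^bsub>fib M (src C g)\<^esub> (res M g ` A)"
  using res_suplat_hom[of g] by (auto simp: suplat_hom_def sup_pres_def into_def)

lemma res_mono:
  assumes "g \<in> into C b" "x \<in> carrier (fib M b)" "y \<in> carrier (fib M b)" "x \<sqsubseteq>\<^bsub>fib M b\<^esub> y"
  shows "res M g x \<sqsubseteq>\<^bsub>fib M (src C g)\<^esub> res M g y"
proof -
  have "isotone (fib M (tgt C g)) (fib M (src C g)) (res M g)"
    using res_suplat_hom[OF into_arr[OF assms(1)]] unfolding suplat_hom_def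
    by (intro join_pres_isotone sup_pres_is_join_pres weak_sup_pres) auto
  then show ?thesis
    using assms by (auto simp: isotone_def into_def)
qed

lemma partial_order_zed: "partial_order (fib (zed C M) a)"
proof
  have po: "partial_order (fib M (src C f))" if "f \<in> into C a" for f
    using complete_at[OF that] by (simp add: complete_lattice_def)
  have wpo: "weak_partial_order (fib M (src C f))" if "f \<in> into C a" for f
    using po[OF that] by (simp add: partial_order_def)
  show eq: "(.=\<^bsub>fib (zed C M) a\<^esub>) = (=)"
    by (simp add: zed_def)
  show "x \<sqsubseteq>\<^bsub>fib (zed C M) a\<^esub> x" if "x \<in> carrier (fib (zed C M) a)" for x
    using wpo zed_value_closed[OF that] by (simp add: le_zed weak_partial_order.le_refl)
  show "x .=\<^bsub>fib (zed C M) a\<^esub> y"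
    if "x \<sqsubseteq>\<^bsub>fib (zed C M) a\<^esub> y" "y \<sqsubseteq>\<^bsub>fib (zed C M) a\<^esub> x"
      "x \<in> carrier (fib (zed C M) a)" "y \<in> carrier (fib (zed C M) a)" for x y
  proof -
    have "x f = y f" if f: "f \<in> into C a" for f
      using that \<open>x \<sqsubseteq>\<^bsub>fib (zed C M) a\<^esub> y\<close> \<open>y \<sqsubseteq>\<^bsub>fib (zed C M) a\<^esub> x\<close>
        zed_value_closed[OF \<open>x \<in> _\<close> f] zed_value_closed[OF \<open>y \<in> _\<close> f]
      by (intro partial_order.le_antisym[OF po[OF f]]) (auto simp: le_zed)
    then show ?thesis
      unfolding eq using that(3,4) by (intro zed_eqI)
  qed
  show "x \<sqsubseteq>\<^bsub>fib (zed C M) a\<^esub> z"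
    if "x \<sqsubseteq>\<^bsub>fib (zed C M) a\<^esub> y" "y \<sqsubseteq>\<^bsub>fib (zed C M) a\<^esub> z" "x \<in> carrier (fib (zed C M) a)"
      "y \<in> carrier (fib (zed C M) a)" "z \<in> carrier (fib (zed C M) a)" for x y z
    unfolding le_zed
  proof
    fix f assume f: "f \<in> into C a"
    show "x f \<sqsubseteq>\<^bsub>fib M (src C f)\<^esub> z f"
      using that(1,2) zed_value_closed[OF that(3) f] zed_value_closed[OF that(4) f]
        zed_value_closed[OF that(5) f] f
      by (intro weak_partial_order.le_trans[OF wpo[OF f], of "x f" "y f" "z f"]) (auto simp: le_zed)
  qed
qed (auto simp: zed_def)

definition pointwise_sup :: "'o \<Rightarrow> ('m \<Rightarrow> 'x) set \<Rightarrow> 'm \<Rightarrow> 'x" where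
  "pointwise_sup a A = (\<lambda>f \<in> into C a. \<Squnion>\<^bsub>fib M (src C f)\<^esub> ((\<lambda>u. u f) ` A))"

definition pointwise_inf :: "'o \<Rightarrow> ('m \<Rightarrow> 'x) set \<Rightarrow> 'm \<Rightarrow> 'x" where
  "pointwise_inf a A = (\<lambda>f \<in> into C a. \<Sqinter>\<^bsub>fib M (src C f)\<^esub> ((\<lambda>u. u f) ` A))"

lemma values_closed:
  "A \<subseteq> carrier (fib (zed C M) a) \<Longrightarrow> f \<in> into C a \<Longrightarrow>
    (\<lambda>u. u f) ` A \<subseteq> carrier (fib M (src C f))"
  by (rule image_subsetI) (rule zed_value_closed, auto)

text \<open>Compatibility passes to pointwise suprema because \<open>M g\<close> commutes with them:
  \<open>M g (\<Squnion> u f) = \<Squnion> M g (u f) \<sqsubseteq> \<Squnion> u (f \<cdot> g)\<close>.\<close>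

lemma pointwise_sup_closed:
  assumes A: "A \<subseteq> carrier (fib (zed C M) a)"
  shows "pointwise_sup a A \<in> carrier (fib (zed C M) a)"
  unfolding carrier_zed
proof (intro conjI ballI)
  show "pointwise_sup a A \<in> (\<Pi>\<^sub>E f \<in> into C a. carrier (fib M (src C f)))"
    unfolding pointwise_sup_def by (simp add: restrict_PiE_iff sup_at_closed values_closed[OF A])
  fix f g assume f: "f \<in> into C a" and g: "g \<in> into C (src C f)"
  interpret G: complete_lattice "fib M (src C g)"
    by (rule complete_at[OF g])
  have fg: "f \<cdot> g \<in> into C a" "src C (f \<cdot> g) = src C g"
    using cmp_into[OF f g] by auto
  have Afg: "(\<lambda>u. u (f \<cdot> g)) ` A \<subseteq> carrier (fib M (src C g))"
    using values_closed[OF A fg(1)] fg(2) by simp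
  have "\<Squnion>\<^bsub>fib M (src C g)\<^esub> (res M g ` (\<lambda>u. u f) ` A)
      \<sqsubseteq>\<^bsub>fib M (src C g)\<^esub> \<Squnion>\<^bsub>fib M (src C g)\<^esub> ((\<lambda>u. u (f \<cdot> g)) ` A)"
  proof (rule G.sup_least)
    show "res M g ` (\<lambda>u. u f) ` A \<subseteq> carrier (fib M (src C g))"
      using values_closed[OF A f] res_closed[OF g] by blast
    fix x assume "x \<in> res M g ` (\<lambda>u. u f) ` A"
    then obtain u where u: "u \<in> A" and x: "x = res M g (u f)" by blast
    have uA: "u \<in> carrier (fib (zed C M) a)"
      using A u by blast
    show "x \<sqsubseteq>\<^bsub>fib M (src C g)\<^esub> \<Squnion>\<^bsub>fib M (src C g)\<^esub> ((\<lambda>u. u (f \<cdot> g)) ` A)"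
    proof (rule G.le_trans)
      show "x \<sqsubseteq>\<^bsub>fib M (src C g)\<^esub> u (f \<cdot> g)"
        unfolding x by (rule zed_value_res[OF uA f g])
      show "u (f \<cdot> g) \<sqsubseteq>\<^bsub>fib M (src C g)\<^esub> \<Squnion>\<^bsub>fib M (src C g)\<^esub> ((\<lambda>u. u (f \<cdot> g)) ` A)"
        using u by (intro G.sup_upper Afg) blast
      show "x \<in> carrier (fib M (src C g))"
        unfolding x by (rule res_closed[OF g zed_value_closed[OF uA f]])
      show "u (f \<cdot> g) \<in> carrier (fib M (src C g))"
        using Afg u by blast
    qed (rule G.sup_closed[OF Afg])
  qed (rule G.sup_closed[OF Afg])
  then show "res M g (pointwise_sup a A f) \<sqsubseteq>\<^bsub>fib M (src C g)\<^esub> pointwise_sup a A (f \<cdot> g)"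
    using f fg res_sup[OF g values_closed[OF A f]] by (simp add: pointwise_sup_def)
qed

text \<open>For infima the inequality \<open>M g (\<Sqinter> u f) \<sqsubseteq> \<Sqinter> M g (u f)\<close> has the right direction, and it
  follows from monotonicity of \<open>M g\<close>.\<close>

lemma pointwise_inf_closed:
  assumes A: "A \<subseteq> carrier (fib (zed C M) a)"
  shows "pointwise_inf a A \<in> carrier (fib (zed C M) a)"
  unfolding carrier_zed
proof (intro conjI ballI)
  show "pointwise_inf a A \<in> (\<Pi>\<^sub>E f \<in> into C a. carrier (fib M (src C f)))"
    unfolding pointwise_inf_def by (simp add: restrict_PiE_iff inf_at_closed values_closed[OF A])
  fix f g assume f: "f \<in> into C a" and g: "g \<in> into C (src C f)"
  interpret F: complete_lattice "fib M (src C f)"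
    by (rule complete_at[OF f])
  interpret G: complete_lattice "fib M (src C g)"
    by (rule complete_at[OF g])
  have fg: "f \<cdot> g \<in> into C a" "src C (f \<cdot> g) = src C g"
    using cmp_into[OF f g] by auto
  have Af: "(\<lambda>u. u f) ` A \<subseteq> carrier (fib M (src C f))"
    by (rule values_closed[OF A f])
  have Afg: "(\<lambda>u. u (f \<cdot> g)) ` A \<subseteq> carrier (fib M (src C g))"
    using values_closed[OF A fg(1)] fg(2) by simp
  let ?i = "\<Sqinter>\<^bsub>fib M (src C f)\<^esub> ((\<lambda>u. u f) ` A)"
  have i: "?i \<in> carrier (fib M (src C f))"
    by (rule F.inf_closed[OF Af])
  have "res M g ?i \<sqsubseteq>\<^bsub>fib M (src C g)\<^esub> \<Sqinter>\<^bsub>fib M (src C g)\<^esub> ((\<lambda>u. u (f \<cdot> g)) ` A)"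
  proof (rule G.inf_greatest[OF Afg res_closed[OF g i]])
    fix x assume "x \<in> (\<lambda>u. u (f \<cdot> g)) ` A"
    then obtain u where u: "u \<in> A" and x: "x = u (f \<cdot> g)" by blast
    have uA: "u \<in> carrier (fib (zed C M) a)"
      using A u by blast
    have uf: "u f \<in> carrier (fib M (src C f))"
      by (rule zed_value_closed[OF uA f])
    show "res M g ?i \<sqsubseteq>\<^bsub>fib M (src C g)\<^esub> x"
    proof (rule G.le_trans)
      show "res M g ?i \<sqsubseteq>\<^bsub>fib M (src C g)\<^esub> res M g (u f)"
        using u by (intro res_mono[OF g i uf] F.inf_lower[OF Af]) blast
      show "res M g (u f) \<sqsubseteq>\<^bsub>fib M (src C g)\<^esub> x"
        unfolding x by (rule zed_value_res[OF uA f g])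
      show "x \<in> carrier (fib M (src C g))"
        unfolding x using Afg u by blast
    qed (rule res_closed[OF g i] res_closed[OF g uf])+
  qed
  then show "res M g (pointwise_inf a A f) \<sqsubseteq>\<^bsub>fib M (src C g)\<^esub> pointwise_inf a A (f \<cdot> g)"
    using f fg by (simp add: pointwise_inf_def)
qed

lemma zed_lub:
  assumes A: "A \<subseteq> carrier (fib (zed C M) a)"
  shows "is_lub (fib (zed C M) a) (pointwise_sup a A) A"
proof (rule least_UpperI[OF _ _ A pointwise_sup_closed[OF A]])
  show "x \<sqsubseteq>\<^bsub>fib (zed C M) a\<^esub> pointwise_sup a A" if "x \<in> A" for x
    unfolding le_zed
  proof
    fix f assume f: "f \<in> into C a"
    interpret F: complete_lattice "fib M (src C f)"
      by (rule complete_at[OF f])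
    show "x f \<sqsubseteq>\<^bsub>fib M (src C f)\<^esub> pointwise_sup a A f"
      using that f F.sup_upper[OF values_closed[OF A f]] by (simp add: pointwise_sup_def)
  qed
  show "pointwise_sup a A \<sqsubseteq>\<^bsub>fib (zed C M) a\<^esub> y" if "y \<in> Upper (fib (zed C M) a) A" for y
    unfolding le_zed
  proof
    fix f assume f: "f \<in> into C a"
    interpret F: complete_lattice "fib M (src C f)"
      by (rule complete_at[OF f])
    have "y \<in> carrier (fib (zed C M) a)" "\<And>u. u \<in> A \<Longrightarrow> u f \<sqsubseteq>\<^bsub>fib M (src C f)\<^esub> y f"
      using that A f by (auto simp: Upper_def le_zed)
    then have "\<Squnion>\<^bsub>fib M (src C f)\<^esub> ((\<lambda>u. u f) ` A) \<sqsubseteq>\<^bsub>fib M (src C f)\<^esub> y f"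
      using zed_value_closed[OF _ f] by (intro F.sup_least[OF values_closed[OF A f]]) auto
    then show "pointwise_sup a A f \<sqsubseteq>\<^bsub>fib M (src C f)\<^esub> y f"
      using f by (simp add: pointwise_sup_def)
  qed
qed

lemma zed_glb:
  assumes A: "A \<subseteq> carrier (fib (zed C M) a)"
  shows "is_glb (fib (zed C M) a) (pointwise_inf a A) A"
proof (rule greatest_LowerI[OF _ _ A pointwise_inf_closed[OF A]])
  show "pointwise_inf a A \<sqsubseteq>\<^bsub>fib (zed C M) a\<^esub> x" if "x \<in> A" for x
    unfolding le_zed
  proof
    fix f assume f: "f \<in> into C a"
    interpret F: complete_lattice "fib M (src C f)"
      by (rule complete_at[OF f])
    show "pointwise_inf a A f \<sqsubseteq>\<^bsub>fib M (src C f)\<^esub> x f"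
      using that f F.inf_lower[OF values_closed[OF A f]] by (simp add: pointwise_inf_def)
  qed
  show "y \<sqsubseteq>\<^bsub>fib (zed C M) a\<^esub> pointwise_inf a A" if "y \<in> Lower (fib (zed C M) a) A" for y
    unfolding le_zed
  proof
    fix f assume f: "f \<in> into C a"
    interpret F: complete_lattice "fib M (src C f)"
      by (rule complete_at[OF f])
    have "y \<in> carrier (fib (zed C M) a)" "\<And>u. u \<in> A \<Longrightarrow> y f \<sqsubseteq>\<^bsub>fib M (src C f)\<^esub> u f"
      using that A f by (auto simp: Lower_def le_zed)
    then have "y f \<sqsubseteq>\<^bsub>fib M (src C f)\<^esub> \<Sqinter>\<^bsub>fib M (src C f)\<^esub> ((\<lambda>u. u f) ` A)"
      using zed_value_closed[OF _ f] by (intro F.inf_greatest[OF values_closed[OF A f]]) auto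
    then show "y f \<sqsubseteq>\<^bsub>fib M (src C f)\<^esub> pointwise_inf a A f"
      using f by (simp add: pointwise_inf_def)
  qed
qed

lemma complete_lattice_zed: "complete_lattice (fib (zed C M) a)"
  using partial_order.complete_latticeI[OF partial_order_zed] zed_lub zed_glb by blast

lemma sup_zed: "A \<subseteq> carrier (fib (zed C M) a) \<Longrightarrow> \<Squnion>\<^bsub>fib (zed C M) a\<^esub> A = pointwise_sup a A"
  by (rule partial_order.sup_eqI[OF partial_order_zed zed_lub])

lemma meet_zed:
  assumes "u \<in> carrier (fib (zed C M) a)" "v \<in> carrier (fib (zed C M) a)"
  shows "u \<sqinter>\<^bsub>fib (zed C M) a\<^esub> v = (\<lambda>f \<in> into C a. u f \<sqinter>\<^bsub>fib M (src C f)\<^esub> v f)"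
proof -
  have "u \<sqinter>\<^bsub>fib (zed C M) a\<^esub> v = pointwise_inf a {u, v}"
    unfolding meet_def
    by (rule partial_order.inf_eqI[OF partial_order_zed zed_glb]) (simp add: assms)
  then show ?thesis
    by (simp add: pointwise_inf_def meet_def)
qed

lemma top_zed: "\<top>\<^bsub>fib (zed C M) a\<^esub> = pointwise_inf a {}"
  using zed_glb[of "{}" a] by (intro partial_order.top_eqI[OF partial_order_zed]) simp

lemma res_zed_closed:
  assumes r: "r \<in> Arr C" and u: "u \<in> carrier (fib (zed C M) (tgt C r))"
  shows "res (zed C M) r u \<in> carrier (fib (zed C M) (src C r))"
  unfolding carrier_zed res_zed
proof (intro conjI ballI)
  note rh = cmp_arr_into[OF r]
  show "(\<lambda>h \<in> into C (src C r). u (r \<cdot> h)) \<in> (\<Pi>\<^sub>E f \<in> into C (src C r). carrier (fib M (src C f)))"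
    using zed_value_closed[OF u rh(1)] rh(2) by auto
  fix f g assume f: "f \<in> into C (src C r)" and g: "g \<in> into C (src C f)"
  have "res M g (u (r \<cdot> f)) \<sqsubseteq>\<^bsub>fib M (src C g)\<^esub> u ((r \<cdot> f) \<cdot> g)"
    using g rh(2)[OF f] by (intro zed_value_res[OF u rh(1)[OF f]]) simp
  then show "res M g ((\<lambda>h \<in> into C (src C r). u (r \<cdot> h)) f)
      \<sqsubseteq>\<^bsub>fib M (src C g)\<^esub> (\<lambda>h \<in> into C (src C r). u (r \<cdot> h)) (f \<cdot> g)"
    using f cmp_into(1)[OF f g] assoc_into[OF r f g] by simp
qed

lemma is_presheaf_zed: "is_presheaf C (zed C M)"
  unfolding is_presheaf_def
proof (intro conjI ballI)
  show "res (zed C M) f \<in> carrier (fib (zed C M) (tgt C f)) \<rightarrow> carrier (fib (zed C M) (src C f))"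
    if "f \<in> Arr C" for f
    using res_zed_closed[OF that] by blast
  show "res (zed C M) (idn C a) x = x"
    if "a \<in> Obj C" "x \<in> carrier (fib (zed C M) a)" for a x
  proof (rule zed_eqI[OF _ that(2)])
    show "res (zed C M) (idn C a) x \<in> carrier (fib (zed C M) a)"
      using res_zed_closed[of "idn C a" x] idn_arr[OF that(1)] that(2) by simp
    show "res (zed C M) (idn C a) x f = x f" if "f \<in> into C a" for f
      using that cmp_idn_into(1)[OF that] idn_into(2)[OF \<open>a \<in> Obj C\<close>] by (simp add: res_zed)
  qed
  show "res (zed C M) (f \<cdot> g) x = res (zed C M) g (res (zed C M) f x)"
    if f: "f \<in> Arr C" and g: "g \<in> into C (src C f)" for f g x
    unfolding res_zed cmp_arr_into(2)[OF f g]
    using cmp_into(1)[OF g] assoc_into[OF f g] by (auto simp: restrict_def fun_eq_iff)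
qed

lemma res_zed_sup:
  assumes r: "r \<in> Arr C" and A: "A \<subseteq> carrier (fib (zed C M) (tgt C r))"
  shows "res (zed C M) r (\<Squnion>\<^bsub>fib (zed C M) (tgt C r)\<^esub> A)
    = \<Squnion>\<^bsub>fib (zed C M) (src C r)\<^esub> (res (zed C M) r ` A)"
proof -
  have rA: "res (zed C M) r ` A \<subseteq> carrier (fib (zed C M) (src C r))"
    using A res_zed_closed[OF r] by blast
  have "pointwise_sup (tgt C r) A (r \<cdot> h)
      = \<Squnion>\<^bsub>fib M (src C h)\<^esub> ((\<lambda>u. u h) ` res (zed C M) r ` A)" if "h \<in> into C (src C r)" for h
    using that cmp_arr_into[OF r that] by (simp add: pointwise_sup_def res_zed image_image)
  then show ?thesis
    unfolding sup_zed[OF A] sup_zed[OF rA] res_zed[where u = "pointwise_sup _ _"]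
      pointwise_sup_def[of "src C r"]
    by (rule restrict_ext)
qed

lemma suplat_hom_res_zed:
  "r \<in> Arr C \<Longrightarrow> suplat_hom (fib (zed C M) (tgt C r)) (fib (zed C M) (src C r)) (res (zed C M) r)"
  unfolding suplat_hom_def sup_pres_def
  using complete_lattice_zed res_zed_closed res_zed_sup by blast

text \<open>Restriction reindexes families, hence commutes with every operation that is computed
  pointwise.\<close>

lemma frame_hom_res_zed:
  assumes r: "r \<in> Arr C"
  shows "frame_hom (fib (zed C M) (tgt C r)) (fib (zed C M) (src C r)) (res (zed C M) r)"
  unfolding frame_hom_def meet_pres_def
proof (intro conjI ballI)
  show "res (zed C M) r \<in> carrier (fib (zed C M) (tgt C r)) \<rightarrow> carrier (fib (zed C M) (src C r))"
    "sup_pres (fib (zed C M) (tgt C r)) (fib (zed C M) (src C r)) (res (zed C M) r)"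
    using suplat_hom_res_zed[OF r] by (auto simp: suplat_hom_def)
  show "res (zed C M) r (x \<sqinter>\<^bsub>fib (zed C M) (tgt C r)\<^esub> y)
      = res (zed C M) r x \<sqinter>\<^bsub>fib (zed C M) (src C r)\<^esub> res (zed C M) r y"
    if "x \<in> carrier (fib (zed C M) (tgt C r))" "y \<in> carrier (fib (zed C M) (tgt C r))" for x y
    unfolding meet_zed[OF that] meet_zed[OF res_zed_closed[OF r that(1)] res_zed_closed[OF r that(2)]]
    using cmp_arr_into[OF r] by (auto simp: res_zed restrict_def fun_eq_iff)
  show "res (zed C M) r \<top>\<^bsub>fib (zed C M) (tgt C r)\<^esub> = \<top>\<^bsub>fib (zed C M) (src C r)\<^esub>"
    using cmp_arr_into[OF r] by (auto simp: top_zed pointwise_inf_def res_zed restrict_def fun_eq_iff)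
qed (simp_all add: complete_lattice_zed)


lemma sigma_summands:
  assumes u: "u \<in> carrier (fib (zed C M) (src C r))" and r: "r \<in> Arr C"
  shows "{u f | f. f \<in> into C (src C r) \<and> r \<cdot> f = g} \<subseteq> carrier (fib M (src C g))"
  using zed_value_closed[OF u] cmp_arr_into(2)[OF r] by force

text \<open>A factorization \<open>g = r \<cdot> f\<close> yields the factorization \<open>g \<cdot> h = r \<cdot> (f \<cdot> h)\<close>, so each summand of
  the value at \<open>g\<close> restricts below a summand of the value at \<open>g \<cdot> h\<close>.\<close>

lemma zed_sigma_closed:
  assumes r: "r \<in> Arr C" and u: "u \<in> carrier (fib (zed C M) (src C r))"
  shows "zed_sigma C M r u \<in> carrier (fib (zed C M) (tgt C r))"
  unfolding carrier_zed
proof (intro conjI ballI)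
  let ?S = "\<lambda>g. {u f | f. f \<in> into C (src C r) \<and> r \<cdot> f = g}"
  note S = sigma_summands[OF u r]
  show "zed_sigma C M r u \<in> (\<Pi>\<^sub>E g \<in> into C (tgt C r). carrier (fib M (src C g)))"
    unfolding zed_sigma_def by (simp add: restrict_PiE_iff sup_at_closed S)
  fix g h assume g: "g \<in> into C (tgt C r)" and h: "h \<in> into C (src C g)"
  interpret H: complete_lattice "fib M (src C h)"
    by (rule complete_at[OF h])
  have gh: "g \<cdot> h \<in> into C (tgt C r)" "src C (g \<cdot> h) = src C h"
    using cmp_into[OF g h] by auto
  have Sgh: "?S (g \<cdot> h) \<subseteq> carrier (fib M (src C h))"
    using S[of "g \<cdot> h"] gh(2) by simp
  have "\<Squnion>\<^bsub>fib M (src C h)\<^esub> (res M h ` ?S g) \<sqsubseteq>\<^bsub>fib M (src C h)\<^esub> \<Squnion>\<^bsub>fib M (src C h)\<^esub> ?S (g \<cdot> h)"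
  proof (rule H.sup_least)
    show "res M h ` ?S g \<subseteq> carrier (fib M (src C h))"
      using S[of g] res_closed[OF h] by blast
    fix x assume "x \<in> res M h ` ?S g"
    then obtain f where f: "f \<in> into C (src C r)" "r \<cdot> f = g" and x: "x = res M h (u f)"
      by blast
    have hf: "h \<in> into C (src C f)"
      using h cmp_arr_into(2)[OF r f(1)] f(2) by simp
    have fh: "f \<cdot> h \<in> into C (src C r)" "src C (f \<cdot> h) = src C h"
      using cmp_into[OF f(1) hf] by auto
    have mem: "u (f \<cdot> h) \<in> ?S (g \<cdot> h)"
      using fh(1) assoc_into[OF r f(1) hf] f(2) by auto
    show "x \<sqsubseteq>\<^bsub>fib M (src C h)\<^esub> \<Squnion>\<^bsub>fib M (src C h)\<^esub> ?S (g \<cdot> h)"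
    proof (rule H.le_trans)
      show "x \<sqsubseteq>\<^bsub>fib M (src C h)\<^esub> u (f \<cdot> h)"
        unfolding x by (rule zed_value_res[OF u f(1) hf])
      show "u (f \<cdot> h) \<sqsubseteq>\<^bsub>fib M (src C h)\<^esub> \<Squnion>\<^bsub>fib M (src C h)\<^esub> ?S (g \<cdot> h)"
        by (rule H.sup_upper[OF Sgh mem])
      show "x \<in> carrier (fib M (src C h))"
        unfolding x by (rule res_closed[OF hf zed_value_closed[OF u f(1)]])
      show "u (f \<cdot> h) \<in> carrier (fib M (src C h))"
        using Sgh mem by blast
    qed (rule H.sup_closed[OF Sgh])
  qed (rule H.sup_closed[OF Sgh])
  then show "res M h (zed_sigma C M r u g) \<sqsubseteq>\<^bsub>fib M (src C h)\<^esub> zed_sigma C M r u (g \<cdot> h)"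
    using g gh res_sup[OF h S[of g]] by (simp add: zed_sigma_def)
qed

lemma zed_sigma_le_iff:
  assumes r: "r \<in> Arr C" and u: "u \<in> carrier (fib (zed C M) (src C r))"
    and v: "v \<in> carrier (fib (zed C M) (tgt C r))"
  shows "zed_sigma C M r u \<sqsubseteq>\<^bsub>fib (zed C M) (tgt C r)\<^esub> v
    \<longleftrightarrow> u \<sqsubseteq>\<^bsub>fib (zed C M) (src C r)\<^esub> res (zed C M) r v"
proof
  let ?S = "\<lambda>g. {u f | f. f \<in> into C (src C r) \<and> r \<cdot> f = g}"
  note S = sigma_summands[OF u r]
  assume le: "zed_sigma C M r u \<sqsubseteq>\<^bsub>fib (zed C M) (tgt C r)\<^esub> v"
  show "u \<sqsubseteq>\<^bsub>fib (zed C M) (src C r)\<^esub> res (zed C M) r v"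
    unfolding le_zed
  proof
    fix f assume f: "f \<in> into C (src C r)"
    note rf = cmp_arr_into[OF r f]
    interpret F: complete_lattice "fib M (src C f)"
      by (rule complete_at[OF f])
    have Sf: "?S (r \<cdot> f) \<subseteq> carrier (fib M (src C f))"
      using S[of "r \<cdot> f"] rf(2) by simp
    have mem: "u f \<in> ?S (r \<cdot> f)"
      using f by blast
    have "u f \<sqsubseteq>\<^bsub>fib M (src C f)\<^esub> v (r \<cdot> f)"
    proof (rule F.le_trans)
      show "u f \<sqsubseteq>\<^bsub>fib M (src C f)\<^esub> \<Squnion>\<^bsub>fib M (src C f)\<^esub> ?S (r \<cdot> f)"
        by (rule F.sup_upper[OF Sf mem])
      show "\<Squnion>\<^bsub>fib M (src C f)\<^esub> ?S (r \<cdot> f) \<sqsubseteq>\<^bsub>fib M (src C f)\<^esub> v (r \<cdot> f)"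
        using bspec[OF le[unfolded le_zed] rf(1)] rf by (simp add: zed_sigma_def)
      show "v (r \<cdot> f) \<in> carrier (fib M (src C f))"
        using zed_value_closed[OF v rf(1)] rf(2) by simp
    qed (rule zed_value_closed[OF u f] F.sup_closed[OF Sf])+
    then show "u f \<sqsubseteq>\<^bsub>fib M (src C f)\<^esub> res (zed C M) r v f"
      using f by (simp add: res_zed)
  qed
next
  let ?S = "\<lambda>g. {u f | f. f \<in> into C (src C r) \<and> r \<cdot> f = g}"
  note S = sigma_summands[OF u r]
  assume le: "u \<sqsubseteq>\<^bsub>fib (zed C M) (src C r)\<^esub> res (zed C M) r v"
  show "zed_sigma C M r u \<sqsubseteq>\<^bsub>fib (zed C M) (tgt C r)\<^esub> v"
    unfolding le_zed
  proof
    fix g assume g: "g \<in> into C (tgt C r)"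
    interpret G: complete_lattice "fib M (src C g)"
      by (rule complete_at[OF g])
    have "\<Squnion>\<^bsub>fib M (src C g)\<^esub> ?S g \<sqsubseteq>\<^bsub>fib M (src C g)\<^esub> v g"
    proof (rule G.sup_least[OF S zed_value_closed[OF v g]])
      fix x assume "x \<in> ?S g"
      then obtain f where f: "f \<in> into C (src C r)" "r \<cdot> f = g" and x: "x = u f"
        by blast
      show "x \<sqsubseteq>\<^bsub>fib M (src C g)\<^esub> v g"
        using bspec[OF le[unfolded le_zed] f(1)] f x cmp_arr_into(2)[OF r f(1)]
        by (simp add: res_zed)
    qed
    then show "zed_sigma C M r u g \<sqsubseteq>\<^bsub>fib M (src C g)\<^esub> v g"
      using g by (simp add: zed_sigma_def)
  qed
qed

lemma left_adjoints_zed: "left_adjoints C (zed C M) (zed_sigma C M)"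
  unfolding left_adjoints_def
proof
  fix f assume f: "f \<in> Arr C"
  show "galois_connection \<lparr>orderA = fib (zed C M) (src C f), orderB = fib (zed C M) (tgt C f),
      lower = zed_sigma C M f, upper = res (zed C M) f\<rparr>"
    unfolding galois_connection_def connection_def galois_connection_axioms_def
    by (auto simp: partial_order_zed zed_sigma_closed[OF f] res_zed_closed[OF f] zed_sigma_le_iff[OF f])
qed

text \<open>Over a weak pullback square, the arrows \<open>f\<close> with \<open>r \<cdot> f = s \<cdot> h\<close> are exactly the \<open>p \<cdot> k\<close> with
  \<open>q \<cdot> k = h\<close>, so both sides are the supremum of one and the same set.\<close>

lemma beck_chevalley_zed: "beck_chevalley C (zed C M) (zed_sigma C M)"
  unfolding beck_chevalley_def
proof (intro allI impI ballI)
  fix r p s q u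
  assume wp: "weak_pullback C r p s q"
  then have arr: "r \<in> Arr C" "p \<in> Arr C" "s \<in> Arr C" "q \<in> Arr C"
    and sq: "tgt C r = tgt C s" "tgt C p = src C r" "tgt C q = src C s" "src C p = src C q"
      "r \<cdot> p = s \<cdot> q"
    by (auto simp: weak_pullback_def)
  have p: "p \<in> into C (src C r)" and q: "q \<in> into C (src C s)"
    using arr sq by (auto simp: into_def)
  have summands: "{u f | f. f \<in> into C (src C r) \<and> r \<cdot> f = s \<cdot> h}
      = {res (zed C M) p u k | k. k \<in> into C (src C q) \<and> q \<cdot> k = h}"
    if h: "h \<in> into C (src C s)" for h
  proof (intro equalityI subsetI)
    fix x assume "x \<in> {u f | f. f \<in> into C (src C r) \<and> r \<cdot> f = s \<cdot> h}"
    then obtain f where f: "f \<in> into C (src C r)" "r \<cdot> f = s \<cdot> h" and x: "x = u f"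
      by blast
    have "src C f = src C h"
      using cmp_arr_into(2)[OF arr(1) f(1)] cmp_arr_into(2)[OF arr(3) h] f(2) by simp
    then obtain k where "k \<in> into C (src C p)" "p \<cdot> k = f" "q \<cdot> k = h"
      using wp f h unfolding weak_pullback_def by blast
    then show "x \<in> {res (zed C M) p u k | k. k \<in> into C (src C q) \<and> q \<cdot> k = h}"
      using x sq(4) by (auto simp: res_zed)
  next
    fix x assume "x \<in> {res (zed C M) p u k | k. k \<in> into C (src C q) \<and> q \<cdot> k = h}"
    then obtain k where k: "k \<in> into C (src C p)" "q \<cdot> k = h" and x: "x = u (p \<cdot> k)"
      using sq(4) by (auto simp: res_zed)
    have "r \<cdot> (p \<cdot> k) = s \<cdot> h"
      using assoc_into[OF arr(1) p k(1)] assoc_into[OF arr(3) q, of k] k sq(4,5) by simp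
    then show "x \<in> {u f | f. f \<in> into C (src C r) \<and> r \<cdot> f = s \<cdot> h}"
      using cmp_into(1)[OF p k(1)] x by blast
  qed
  have "res (zed C M) s (zed_sigma C M r u)
      = (\<lambda>h \<in> into C (src C s). \<Squnion>\<^bsub>fib M (src C h)\<^esub> {u f | f. f \<in> into C (src C r) \<and> r \<cdot> f = s \<cdot> h})"
    unfolding res_zed
  proof (rule restrict_ext)
    fix h assume h: "h \<in> into C (src C s)"
    show "zed_sigma C M r u (s \<cdot> h)
        = \<Squnion>\<^bsub>fib M (src C h)\<^esub> {u f | f. f \<in> into C (src C r) \<and> r \<cdot> f = s \<cdot> h}"
      using cmp_arr_into[OF arr(3) h] sq(1) by (simp add: zed_sigma_def)
  qed
  also have "\<dots> = zed_sigma C M q (res (zed C M) p u)"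
    unfolding zed_sigma_def sq(3) by (rule restrict_ext) (simp only: summands)
  finally show "res (zed C M) s (zed_sigma C M r u) = zed_sigma C M q (res (zed C M) p u)" .
qed

theorem internal_suplattice_zed: "internal_suplattice C (zed C M) (zed_sigma C M)"
  unfolding internal_suplattice_def
  using is_presheaf_zed complete_lattice_zed suplat_hom_res_zed left_adjoints_zed beck_chevalley_zed
  by blast

end

text \<open>Suprema and binary meets of families are pointwise and the \<open>\<Sigma>\<^sub>r\<close> are suprema, so distributivity
  and Frobenius reciprocity are both instances of the frame law in single fibres. For Frobenius, all
  the summands \<open>u (r \<cdot> f) \<sqinter> v f\<close> with \<open>r \<cdot> f = g\<close> have the same first factor \<open>u g\<close>.\<close>

locale suplat_presheaf_of_frames = suplat_presheaf +
  assumes frame_fib: "a \<in> Obj C \<Longrightarrow> frame (fib M a)"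
begin

lemma frame_law_at:
  assumes "f \<in> into C a" "x \<in> carrier (fib M (src C f))" "V \<subseteq> carrier (fib M (src C f))"
  shows "x \<sqinter>\<^bsub>fib M (src C f)\<^esub> (\<Squnion>\<^bsub>fib M (src C f)\<^esub> V)
    = \<Squnion>\<^bsub>fib M (src C f)\<^esub> ((\<lambda>v. x \<sqinter>\<^bsub>fib M (src C f)\<^esub> v) ` V)"
  using frame_fib[OF src_into[OF assms(1)]] assms(2,3) by (simp add: frame_def)

lemma meet_zed_closed:
  assumes "u \<in> carrier (fib (zed C M) a)" "v \<in> carrier (fib (zed C M) a)"
  shows "u \<sqinter>\<^bsub>fib (zed C M) a\<^esub> v \<in> carrier (fib (zed C M) a)"
proof -
  interpret complete_lattice "fib (zed C M) a"
    by (rule complete_lattice_zed)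
  show ?thesis
    using assms by (rule meet_closed)
qed

lemma frame_zed: "frame (fib (zed C M) a)"
  unfolding frame_def
proof (intro conjI ballI allI impI)
  show "complete_lattice (fib (zed C M) a)"
    by (rule complete_lattice_zed)
  fix u V assume u: "u \<in> carrier (fib (zed C M) a)" and V: "V \<subseteq> carrier (fib (zed C M) a)"
  have meets: "(\<lambda>v. u \<sqinter>\<^bsub>fib (zed C M) a\<^esub> v) ` V \<subseteq> carrier (fib (zed C M) a)"
    using V meet_zed_closed[OF u] by blast
  have "u f \<sqinter>\<^bsub>fib M (src C f)\<^esub> pointwise_sup a V f
      = pointwise_sup a ((\<lambda>v. u \<sqinter>\<^bsub>fib (zed C M) a\<^esub> v) ` V) f" if f: "f \<in> into C a" for f
  proof -
    have "(u \<sqinter>\<^bsub>fib (zed C M) a\<^esub> v) f = u f \<sqinter>\<^bsub>fib M (src C f)\<^esub> v f" if "v \<in> V" for v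
      using that V f by (subst meet_zed[OF u]) auto
    then show ?thesis
      using f frame_law_at[OF f zed_value_closed[OF u f] values_closed[OF V f]]
      by (simp add: pointwise_sup_def image_image cong: image_cong_simp)
  qed
  then show "u \<sqinter>\<^bsub>fib (zed C M) a\<^esub> (\<Squnion>\<^bsub>fib (zed C M) a\<^esub> V)
      = \<Squnion>\<^bsub>fib (zed C M) a\<^esub> ((\<lambda>v. u \<sqinter>\<^bsub>fib (zed C M) a\<^esub> v) ` V)"
    unfolding sup_zed[OF V] sup_zed[OF meets]
    by (intro zed_eqI[OF meet_zed_closed[OF u pointwise_sup_closed[OF V]] pointwise_sup_closed[OF meets]])
      (simp add: meet_zed[OF u pointwise_sup_closed[OF V]])
qed

lemma frobenius_zed: "frobenius C (zed C M) (zed_sigma C M)"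
  unfolding frobenius_def
proof (intro ballI)
  fix r u v
  assume r: "r \<in> Arr C" and u: "u \<in> carrier (fib (zed C M) (tgt C r))"
    and v: "v \<in> carrier (fib (zed C M) (src C r))"
  let ?w = "res (zed C M) r u \<sqinter>\<^bsub>fib (zed C M) (src C r)\<^esub> v"
  have ru: "res (zed C M) r u \<in> carrier (fib (zed C M) (src C r))"
    by (rule res_zed_closed[OF r u])
  have w: "?w \<in> carrier (fib (zed C M) (src C r))"
    by (rule meet_zed_closed[OF ru v])
  have w_at: "?w f = u (r \<cdot> f) \<sqinter>\<^bsub>fib M (src C (r \<cdot> f))\<^esub> v f" if "f \<in> into C (src C r)" for f
    using that cmp_arr_into(2)[OF r that] unfolding meet_zed[OF ru v] by (simp add: res_zed)
  have \<sigma>v: "zed_sigma C M r v \<in> carrier (fib (zed C M) (tgt C r))"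
    by (rule zed_sigma_closed[OF r v])
  have "zed_sigma C M r ?w g = u g \<sqinter>\<^bsub>fib M (src C g)\<^esub> zed_sigma C M r v g"
    if g: "g \<in> into C (tgt C r)" for g
  proof -
    have "{?w f | f. f \<in> into C (src C r) \<and> r \<cdot> f = g}
        = (\<lambda>x. u g \<sqinter>\<^bsub>fib M (src C g)\<^esub> x) ` {v f | f. f \<in> into C (src C r) \<and> r \<cdot> f = g}"
      using w_at by (auto simp: image_def) metis+
    then show ?thesis
      using frame_law_at[OF g zed_value_closed[OF u g] sigma_summands[OF v r]] g
      by (simp add: zed_sigma_def)
  qed
  then show "zed_sigma C M r ?w = u \<sqinter>\<^bsub>fib (zed C M) (tgt C r)\<^esub> zed_sigma C M r v"
    by (intro zed_eqI[OF zed_sigma_closed[OF r w] meet_zed_closed[OF u \<sigma>v]])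
      (simp add: meet_zed[OF u \<sigma>v])
qed

theorem internal_frame_zed: "internal_frame C (zed C M) (zed_sigma C M)"
  unfolding internal_frame_def
  using is_presheaf_zed frame_zed frame_hom_res_zed left_adjoints_zed beck_chevalley_zed frobenius_zed
  by blast

end


section \<open>Internal ideals are families of ideals\<close>

locale presheaf_of_jsl = small_category C for C :: "('o, 'm) cat" (structure) +
  fixes L :: "('o, 'm, 'x) presheaf"
  assumes jsl_presheaf: "jsl_presheaf C L"
begin

lemma jsl_fib: "a \<in> Obj C \<Longrightarrow> jsl (fib L a)"
  using jsl_presheaf by (simp add: jsl_presheaf_def jsl_if_join_semilattice)

lemma jsl_morphism_res:
  "g \<in> into C a \<Longrightarrow> jsl_morphism (fib L a) (fib L (src C g)) (res L g)"
  using jsl_presheaf jsl_fib src_closed tgt_closed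
  by (auto simp: jsl_morphism_def jsl_morphism_axioms_def jsl_presheaf_def into_def)

lemma res_L_closed:
  "g \<in> into C a \<Longrightarrow> x \<in> carrier (fib L a) \<Longrightarrow> res L g x \<in> carrier (fib L (src C g))"
  by (rule jsl_morphism.hom_closed[OF jsl_morphism_res])

lemma res_L_bottom: "g \<in> into C a \<Longrightarrow> res L g \<bottom>\<^bsub>fib L a\<^esub> = \<bottom>\<^bsub>fib L (src C g)\<^esub>"
  using jsl_morphism.hom[OF jsl_morphism_res] by (simp add: jsl_hom_def)

lemma res_L_idn: "a \<in> Obj C \<Longrightarrow> x \<in> carrier (fib L a) \<Longrightarrow> res L (idn C a) x = x"
  using jsl_presheaf by (simp add: jsl_presheaf_def is_presheaf_def)

lemma res_L_cmp:
  "f \<in> into C a \<Longrightarrow> g \<in> into C (src C f) \<Longrightarrow> x \<in> carrier (fib L a) \<Longrightarrow>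
    res L (f \<cdot> g) x = res L g (res L f x)"
  using jsl_presheaf by (auto simp: jsl_presheaf_def is_presheaf_def into_def)

lemma is_presheaf_idl: "is_presheaf C (idl_presheaf C L)"
  unfolding is_presheaf_def
proof (intro conjI ballI)
  show "res (idl_presheaf C L) f
      \<in> carrier (fib (idl_presheaf C L) (tgt C f)) \<rightarrow> carrier (fib (idl_presheaf C L) (src C f))"
    if "f \<in> Arr C" for f
    using jsl_morphism.suplat_hom_direct_image[OF jsl_morphism_res[OF into_tgt[OF that]]]
    by (simp add: suplat_hom_def idl_presheaf_def)
next
  fix a I assume a: "a \<in> Obj C" and "I \<in> carrier (fib (idl_presheaf C L) a)"
  then have I: "jsl_ideal (fib L a) I"
    by (simp add: idl_presheaf_def)
  then have "res L (idn C a) ` I = I"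
    using res_L_idn[OF a] jsl_ideal_subset[OF I] by force
  then show "res (idl_presheaf C L) (idn C a) I = I"
    using idn_into(2)[OF a] by (simp add: idl_presheaf_def ideal_generated_ideal_eq I)
next
  fix f g I
  assume f: "f \<in> Arr C" and g: "g \<in> into C (src C f)"
    and "I \<in> carrier (fib (idl_presheaf C L) (tgt C f))"
  then have I: "I \<subseteq> carrier (fib L (tgt C f))"
    by (simp add: idl_presheaf_def jsl_ideal_subset)
  have "res L f ` I \<subseteq> carrier (fib L (src C f))"
    using I res_L_closed[OF into_tgt[OF f]] by blast
  then have "ideal_generated (fib L (src C g)) (res L g ` ideal_generated (fib L (src C f)) (res L f ` I))
      = ideal_generated (fib L (src C g)) (res L g ` res L f ` I)"
    by (rule jsl_morphism.image_generated[OF jsl_morphism_res[OF g]])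
  also have "res L g ` res L f ` I = res L (f \<cdot> g) ` I"
    using I res_L_cmp[OF into_tgt[OF f] g] by (force simp: image_image)
  finally show "res (idl_presheaf C L) (f \<cdot> g) I
      = res (idl_presheaf C L) g (res (idl_presheaf C L) f I)"
    using cmp_arr_into(2)[OF f g] by (simp add: idl_presheaf_def)
qed

sublocale idl: suplat_presheaf C "idl_presheaf C L"
proof (intro suplat_presheaf.intro suplat_presheaf_axioms.intro)
  show "small_category C"
    by (rule small_category_axioms)
  show "is_presheaf C (idl_presheaf C L)"
    by (rule is_presheaf_idl)
  show "complete_lattice (fib (idl_presheaf C L) a)" if "a \<in> Obj C" for a
    using jsl.complete_lattice_idl[OF jsl_fib[OF that]] by (simp add: idl_presheaf_def)
  show "suplat_hom (fib (idl_presheaf C L) (tgt C f)) (fib (idl_presheaf C L) (src C f))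
      (res (idl_presheaf C L) f)" if "f \<in> Arr C" for f
    using jsl_morphism.suplat_hom_direct_image[OF jsl_morphism_res[OF into_tgt[OF that]]]
    by (simp add: idl_presheaf_def)
qed

definition slice :: "('m \<times> 'x) set \<Rightarrow> 'm \<Rightarrow> 'x set" where
  "slice I f = {x. (f, x) \<in> I}"

lemma slice_closed: "I \<in> subpresheaves C L a \<Longrightarrow> slice I f \<subseteq> carrier (fib L (src C f))"
  by (auto simp: subpresheaves_def slice_def)

lemma slice_res:
  "I \<in> subpresheaves C L a \<Longrightarrow> f \<in> into C a \<Longrightarrow> g \<in> into C (src C f) \<Longrightarrow>
    res L g ` slice I f \<subseteq> slice I (f \<cdot> g)"
  by (auto simp: subpresheaves_def slice_def)

lemma pow_res_iff:
  "(h, x) \<in> pow_res C L r S \<longleftrightarrow>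
    h \<in> into C (src C r) \<and> x \<in> carrier (fib L (src C h)) \<and> (r \<cdot> h, x) \<in> S"
  by (auto simp: pow_res_def)

text \<open>Each clause of \<open>ideal_form\<close> has two universal quantifiers and one implication, and each of these
  three connectives moves to a later stage. Its body is therefore forced at the end of a chain of three
  arrows, where membership in the restricted \<open>I\<close> means membership in the slice at the composite.\<close>

lemma mem_pow_res3:
  assumes I: "I \<in> subpresheaves C L a"
    and g: "g \<in> into C a" and h: "h \<in> into C (src C g)" and k: "k \<in> into C (src C h)"
  shows "(idn C (src C k), x) \<in> pow_res C L k (pow_res C L h (pow_res C L g I)) \<longleftrightarrow>
    x \<in> slice I (g \<cdot> (h \<cdot> k))"
proof -
  have "src C (g \<cdot> (h \<cdot> k)) = src C k"
    using cmp_into(2)[OF g] cmp_into[OF h k] by simp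
  then show ?thesis
    using slice_closed[OF I, of "g \<cdot> (h \<cdot> k)"] idn_into[OF src_into[OF k]] cmp_idn_into(2)[OF k]
      cmp_into[OF h k] h k by (auto simp: pow_res_iff slice_def)
qed

lemma forces_ideal_form_unfold:
  assumes I: "I \<in> subpresheaves C L a"
  shows "forces C L ideal_form a I e \<longleftrightarrow>
    \<bottom>\<^bsub>fib L a\<^esub> \<in> slice I (idn C a) \<and>
    (\<forall>g \<in> into C a. \<forall>x \<in> carrier (fib L (src C g)).
      \<forall>h \<in> into C (src C g). \<forall>y \<in> carrier (fib L (src C h)). \<forall>k \<in> into C (src C h).
        res L k (res L h x) \<sqsubseteq>\<^bsub>fib L (src C k)\<^esub> res L k y \<and> res L k y \<in> slice I (g \<cdot> (h \<cdot> k))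
        \<longrightarrow> res L k (res L h x) \<in> slice I (g \<cdot> (h \<cdot> k))) \<and>
    (\<forall>g \<in> into C a. \<forall>x \<in> carrier (fib L (src C g)).
      \<forall>h \<in> into C (src C g). \<forall>y \<in> carrier (fib L (src C h)). \<forall>k \<in> into C (src C h).
        res L k (res L h x) \<in> slice I (g \<cdot> (h \<cdot> k)) \<and> res L k y \<in> slice I (g \<cdot> (h \<cdot> k))
        \<longrightarrow> res L k (res L h x) \<squnion>\<^bsub>fib L (src C k)\<^esub> res L k y \<in> slice I (g \<cdot> (h \<cdot> k)))"
  by (simp add: ideal_form_def mem_pow_res3[OF I] slice_def[of I "idn C a"] cong: ball_cong)

text \<open>The slice at \<open>f\<close> is reached by instantiating the three changes of stage with \<open>f\<close> and two
  identities. Conversely, what is forced along the chain \<open>g, h, k\<close> only concerns the slice at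
  \<open>g \<cdot> (h \<cdot> k)\<close>.\<close>

lemma forces_ideal_form_iff:
  assumes a: "a \<in> Obj C" and I: "I \<in> subpresheaves C L a"
  shows "forces C L ideal_form a I e \<longleftrightarrow> (\<forall>f \<in> into C a. jsl_ideal (fib L (src C f)) (slice I f))"
proof (intro iffI ballI)
  fix f assume forced: "forces C L ideal_form a I e" and f: "f \<in> into C a"
  let ?b = "src C f"
  let ?i = "idn C ?b"
  have b: "?b \<in> Obj C"
    by (rule src_into[OF f])
  note i = idn_into[OF b]
  have ii: "?i \<in> into C (src C ?i)" "f \<cdot> (?i \<cdot> ?i) = f"
    using i cmp_idn_into(2)[OF i(1)] cmp_idn_into(2)[OF f] by auto
  note unfolded = forced[unfolded forces_ideal_form_unfold[OF I]]
  note bottom = unfolded[THEN conjunct1]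
  note down = unfolded[THEN conjunct2, THEN conjunct1, rule_format, OF f _ i(1) _ ii(1)]
  note join = unfolded[THEN conjunct2, THEN conjunct2, rule_format, OF f _ i(1) _ ii(1)]
  show "jsl_ideal (fib L ?b) (slice I f)"
    unfolding jsl_ideal_def
  proof (intro conjI ballI impI)
    show sub: "slice I f \<subseteq> carrier (fib L ?b)"
      by (rule slice_closed[OF I])
    (* The bottom clause speaks about the identity of a only; it reaches f by restriction. *)
    show "\<bottom>\<^bsub>fib L ?b\<^esub> \<in> slice I f"
      using slice_res[OF I idn_into(1)[OF a], of f] bottom f idn_into(2)[OF a] cmp_idn_into(1)[OF f]
        res_L_bottom[OF f] by force
    show "x \<in> slice I f"
      if "x \<in> carrier (fib L ?b)" "y \<in> slice I f" "x \<sqsubseteq>\<^bsub>fib L ?b\<^esub> y" for x y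
      using down[of x y] that subsetD[OF sub that(2)] i(2) ii(2) by (simp add: res_L_idn[OF b])
    show "x \<squnion>\<^bsub>fib L ?b\<^esub> y \<in> slice I f" if "x \<in> slice I f" "y \<in> slice I f" for x y
      using join[of x y] that subsetD[OF sub that(1)] subsetD[OF sub that(2)] i(2) ii(2)
      by (simp add: res_L_idn[OF b])
  qed
next
  assume ideals: "\<forall>f \<in> into C a. jsl_ideal (fib L (src C f)) (slice I f)"
  have ideal: "jsl_ideal (fib L (src C k)) (slice I (g \<cdot> (h \<cdot> k)))"
    if g: "g \<in> into C a" and h: "h \<in> into C (src C g)" and k: "k \<in> into C (src C h)" for g h k
    using bspec[OF ideals cmp_into(1)[OF g cmp_into(1)[OF h k]]]
      cmp_into(2)[OF g cmp_into(1)[OF h k]] cmp_into(2)[OF h k] by simp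
  have "\<bottom>\<^bsub>fib L a\<^esub> \<in> slice I (idn C a)"
    using bspec[OF ideals idn_into(1)[OF a]] idn_into(2)[OF a] by (simp add: jsl_ideal_def)
  then show "forces C L ideal_form a I e"
    unfolding forces_ideal_form_unfold[OF I]
  proof (intro conjI ballI impI; (elim conjE)?)
    fix g x h y k
    assume g: "g \<in> into C a" and x: "x \<in> carrier (fib L (src C g))" and h: "h \<in> into C (src C g)"
      and y: "y \<in> carrier (fib L (src C h))" and k: "k \<in> into C (src C h)"
    note ideal' = ideal[OF g h k, unfolded jsl_ideal_def]
    show "res L k (res L h x) \<in> slice I (g \<cdot> (h \<cdot> k))"
      if "res L k (res L h x) \<sqsubseteq>\<^bsub>fib L (src C k)\<^esub> res L k y" "res L k y \<in> slice I (g \<cdot> (h \<cdot> k))"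
      using ideal' that res_L_closed[OF k res_L_closed[OF h x]] by blast
    show "res L k (res L h x) \<squnion>\<^bsub>fib L (src C k)\<^esub> res L k y \<in> slice I (g \<cdot> (h \<cdot> k))"
      if "res L k (res L h x) \<in> slice I (g \<cdot> (h \<cdot> k))" "res L k y \<in> slice I (g \<cdot> (h \<cdot> k))"
      using ideal' that by blast
  qed
qed

lemma carrier_internal_idl:
  assumes "a \<in> Obj C"
  shows "I \<in> carrier (fib (internal_idl C L) a) \<longleftrightarrow>
    I \<in> subpresheaves C L a \<and> (\<forall>f \<in> into C a. jsl_ideal (fib L (src C f)) (slice I f))"
  using forces_ideal_form_iff[OF assms] by (auto simp: internal_idl_def)

lemma slice_pow_res:
  assumes "I \<in> subpresheaves C L (tgt C r)" "r \<in> Arr C" "h \<in> into C (src C r)"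
  shows "slice (pow_res C L r I) h = slice I (r \<cdot> h)"
  using slice_closed[OF assms(1), of "r \<cdot> h"] cmp_arr_into(2)[OF assms(2,3)] assms(3)
  by (auto simp: slice_def pow_res_iff)

lemma subpresheaf_eqI:
  assumes "I \<in> subpresheaves C L a" "J \<in> subpresheaves C L a"
    and "\<And>f. f \<in> into C a \<Longrightarrow> slice I f = slice J f"
  shows "I = J"
proof -
  have "(f, x) \<in> I \<longleftrightarrow> (f, x) \<in> J" for f x
  proof (cases "f \<in> into C a")
    case True
    then show ?thesis
      using assms(3)[OF True] by (auto simp: slice_def)
  next
    case False
    then show ?thesis
      using assms(1,2) by (auto simp: subpresheaves_def)
  qed
  then show ?thesis
    by auto
qed

lemma pow_res_subpresheaf:
  assumes r: "r \<in> Arr C" and I: "I \<in> subpresheaves C L (tgt C r)"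
  shows "pow_res C L r I \<in> subpresheaves C L (src C r)"
proof -
  have "(h \<cdot> g, res L g x) \<in> pow_res C L r I"
    if "(h, x) \<in> pow_res C L r I" and g: "g \<in> into C (src C h)" for h x g
  proof -
    have h: "h \<in> into C (src C r)" and x: "x \<in> carrier (fib L (src C h))" and m: "(r \<cdot> h, x) \<in> I"
      using that(1) by (auto simp: pow_res_iff)
    have "((r \<cdot> h) \<cdot> g, res L g x) \<in> I"
      using I m g cmp_arr_into(2)[OF r h] by (auto simp: subpresheaves_def)
    then show ?thesis
      using assoc_into[OF r h g] cmp_into[OF h g] res_L_closed[OF g x] by (simp add: pow_res_iff)
  qed
  then show ?thesis
    by (auto simp: subpresheaves_def pow_res_iff)
qed

lemma is_presheaf_internal_idl: "is_presheaf C (internal_idl C L)"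
  unfolding is_presheaf_def
proof (intro conjI ballI)
  have res: "res (internal_idl C L) = pow_res C L"
    by (simp add: internal_idl_def)
  show "res (internal_idl C L) f
      \<in> carrier (fib (internal_idl C L) (tgt C f)) \<rightarrow> carrier (fib (internal_idl C L) (src C f))"
    if f: "f \<in> Arr C" for f
  proof
    fix I assume "I \<in> carrier (fib (internal_idl C L) (tgt C f))"
    then have I: "I \<in> subpresheaves C L (tgt C f)"
      and ideals: "\<And>g. g \<in> into C (tgt C f) \<Longrightarrow> jsl_ideal (fib L (src C g)) (slice I g)"
      by (auto simp: carrier_internal_idl[OF tgt_closed[OF f]])
    have "jsl_ideal (fib L (src C h)) (slice (pow_res C L f I) h)" if "h \<in> into C (src C f)" for h
      using ideals[OF cmp_arr_into(1)[OF f that]] cmp_arr_into(2)[OF f that]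
      by (simp add: slice_pow_res[OF I f that])
    then show "res (internal_idl C L) f I \<in> carrier (fib (internal_idl C L) (src C f))"
      by (simp add: res carrier_internal_idl[OF src_closed[OF f]] pow_res_subpresheaf[OF f I])
  qed
  show "res (internal_idl C L) (idn C a) I = I"
    if a: "a \<in> Obj C" and "I \<in> carrier (fib (internal_idl C L) a)" for a I
  proof -
    have I: "I \<in> subpresheaves C L (tgt C (idn C a))"
      using that idn_arr[OF a] by (simp add: carrier_internal_idl)
    have "pow_res C L (idn C a) I \<in> subpresheaves C L a"
      using pow_res_subpresheaf[OF _ I] idn_arr[OF a] by simp
    moreover have "slice (pow_res C L (idn C a) I) f = slice I f" if "f \<in> into C a" for f
      using that slice_pow_res[OF I, of f] idn_arr[OF a] cmp_idn_into(1)[OF that] by simp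
    ultimately show ?thesis
      unfolding res using I idn_arr[OF a] by (intro subpresheaf_eqI[of _ a]) auto
  qed
  show "res (internal_idl C L) (f \<cdot> g) I = res (internal_idl C L) g (res (internal_idl C L) f I)"
    if f: "f \<in> Arr C" and g: "g \<in> into C (src C f)"
      and "I \<in> carrier (fib (internal_idl C L) (tgt C f))" for f g I
  proof -
    have gA: "g \<in> Arr C" "tgt C g = src C f"
      using g by (auto simp: into_def)
    have I: "I \<in> subpresheaves C L (tgt C f)"
      using that(3) by (simp add: carrier_internal_idl[OF tgt_closed[OF f]])
    have fg: "f \<cdot> g \<in> Arr C" "src C (f \<cdot> g) = src C g" "tgt C (f \<cdot> g) = tgt C f"
      using cmp_arr[OF f gA] by auto
    have fI: "pow_res C L f I \<in> subpresheaves C L (tgt C g)"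
      using pow_res_subpresheaf[OF f I] gA by simp
    have fgI: "I \<in> subpresheaves C L (tgt C (f \<cdot> g))"
      using I fg by simp
    show ?thesis
      unfolding res
    proof (rule subpresheaf_eqI)
      show "pow_res C L (f \<cdot> g) I \<in> subpresheaves C L (src C g)"
        using pow_res_subpresheaf[OF fg(1) fgI] fg(2) by simp
      show "pow_res C L g (pow_res C L f I) \<in> subpresheaves C L (src C g)"
        by (rule pow_res_subpresheaf[OF gA(1) fI])
      fix h assume h: "h \<in> into C (src C g)"
      show "slice (pow_res C L (f \<cdot> g) I) h = slice (pow_res C L g (pow_res C L f I)) h"
        using slice_pow_res[OF fgI fg(1), of h] slice_pow_res[OF fI gA(1) h]
          slice_pow_res[OF I f cmp_into(1)[OF g h]] assoc_into[OF f g h] h fg(2) by simp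
    qed
  qed
qed

definition family_of_slices :: "'o \<Rightarrow> ('m \<times> 'x) set \<Rightarrow> 'm \<Rightarrow> 'x set" where
  "family_of_slices a I = (\<lambda>f \<in> into C a. slice I f)"

text \<open>For families of ideals, the compatibility condition may be tested on direct images instead of
  on the ideals that they generate; in this form it is the closure condition on sub-presheaves.\<close>

lemma carrier_zed_idl:
  "u \<in> carrier (fib (zed C (idl_presheaf C L)) a) \<longleftrightarrow>
    u \<in> extensional (into C a) \<and> (\<forall>f \<in> into C a. jsl_ideal (fib L (src C f)) (u f)) \<and>
    (\<forall>f \<in> into C a. \<forall>g \<in> into C (src C f). res L g ` u f \<subseteq> u (f \<cdot> g))"
    (is "?lhs \<longleftrightarrow> ?rhs")
proof -
  have gen: "ideal_generated (fib L (src C g)) (res L g ` u f) \<subseteq> u (f \<cdot> g) \<longleftrightarrow> res L g ` u f \<subseteq> u (f \<cdot> g)"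
    if "\<forall>f \<in> into C a. jsl_ideal (fib L (src C f)) (u f)"
      and f: "f \<in> into C a" and g: "g \<in> into C (src C f)" for f g
    using bspec[OF that(1) cmp_into(1)[OF f g]] cmp_into(2)[OF f g]
    by (simp add: ideal_generated_le_iff)
  have "?lhs \<longleftrightarrow> u \<in> extensional (into C a) \<and> (\<forall>f \<in> into C a. jsl_ideal (fib L (src C f)) (u f)) \<and>
      (\<forall>f \<in> into C a. \<forall>g \<in> into C (src C f).
        ideal_generated (fib L (src C g)) (res L g ` u f) \<subseteq> u (f \<cdot> g))"
    by (simp add: carrier_zed PiE_iff idl_presheaf_def conj_commute conj_left_commute)
  also have "\<dots> \<longleftrightarrow> ?rhs"
    using gen by (intro conj_cong refl ball_cong) blast+
  finally show ?thesis .
qed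

lemma le_zed_idl:
  "u \<sqsubseteq>\<^bsub>fib (zed C (idl_presheaf C L)) a\<^esub> v \<longleftrightarrow> (\<forall>f \<in> into C a. u f \<subseteq> v f)"
  by (simp add: le_zed idl_presheaf_def)

lemma bij_family_of_slices:
  assumes a: "a \<in> Obj C"
  shows "bij_betw (family_of_slices a) (carrier (fib (internal_idl C L) a))
    (carrier (fib (zed C (idl_presheaf C L)) a))"
proof (rule bij_betw_imageI)
  show "inj_on (family_of_slices a) (carrier (fib (internal_idl C L) a))"
  proof (rule inj_onI)
    fix I J assume "I \<in> carrier (fib (internal_idl C L) a)" "J \<in> carrier (fib (internal_idl C L) a)"
      and eq: "family_of_slices a I = family_of_slices a J"
    then have "I \<in> subpresheaves C L a" "J \<in> subpresheaves C L a"
      by (auto simp: carrier_internal_idl[OF a])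
    moreover have "slice I f = slice J f" if "f \<in> into C a" for f
      using fun_cong[OF eq, of f] that by (simp add: family_of_slices_def)
    ultimately show "I = J"
      by (rule subpresheaf_eqI)
  qed
  show "family_of_slices a ` carrier (fib (internal_idl C L) a)
      = carrier (fib (zed C (idl_presheaf C L)) a)"
  proof (intro equalityI subsetI)
    fix u assume "u \<in> family_of_slices a ` carrier (fib (internal_idl C L) a)"
    then obtain I where I: "I \<in> subpresheaves C L a"
      and ideals: "\<forall>f \<in> into C a. jsl_ideal (fib L (src C f)) (slice I f)"
      and u: "u = family_of_slices a I"
      by (auto simp: carrier_internal_idl[OF a])
    show "u \<in> carrier (fib (zed C (idl_presheaf C L)) a)"
      unfolding carrier_zed_idl u family_of_slices_def
      using ideals slice_res[OF I] cmp_into(1) by simp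
  next
    fix u assume "u \<in> carrier (fib (zed C (idl_presheaf C L)) a)"
    then have ext: "u \<in> extensional (into C a)"
      and ideals: "\<And>f. f \<in> into C a \<Longrightarrow> jsl_ideal (fib L (src C f)) (u f)"
      and restr: "\<And>f g. f \<in> into C a \<Longrightarrow> g \<in> into C (src C f) \<Longrightarrow> res L g ` u f \<subseteq> u (f \<cdot> g)"
      by (auto simp: carrier_zed_idl)
    let ?I = "{(f, x). f \<in> into C a \<and> x \<in> u f}"
    have sl: "slice ?I f = u f" if "f \<in> into C a" for f
      using that by (simp add: slice_def)
    have "?I \<in> subpresheaves C L a"
      unfolding subpresheaves_def using jsl_ideal_subset[OF ideals] restr cmp_into(1) by blast
    then have "?I \<in> carrier (fib (internal_idl C L) a)"
      using ideals sl by (simp add: carrier_internal_idl[OF a])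
    moreover have "u = family_of_slices a ?I"
      unfolding family_of_slices_def using ext sl by (intro extensionalityI[OF ext]) auto
    ultimately show "u \<in> family_of_slices a ` carrier (fib (internal_idl C L) a)"
      by blast
  qed
qed

lemma order_emb_family_of_slices:
  assumes a: "a \<in> Obj C"
  shows "order_emb (fib (internal_idl C L) a) (fib (zed C (idl_presheaf C L)) a) (family_of_slices a)"
  unfolding order_emb_def
proof (intro conjI ballI)
  show "weak_partial_order (fib (internal_idl C L) a)"
    by unfold_locales (auto simp: internal_idl_def)
  show "weak_partial_order (fib (zed C (idl_presheaf C L)) a)"
    using idl.partial_order_zed by (simp add: partial_order_def)
  fix I J assume "I \<in> carrier (fib (internal_idl C L) a)"
  then have "I \<subseteq> (SIGMA f : into C a. carrier (fib L (src C f)))"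
    by (simp add: carrier_internal_idl[OF a] subpresheaves_def)
  then show "family_of_slices a I \<sqsubseteq>\<^bsub>fib (zed C (idl_presheaf C L)) a\<^esub> family_of_slices a J
      \<longleftrightarrow> I \<sqsubseteq>\<^bsub>fib (internal_idl C L) a\<^esub> J"
    by (auto simp: le_zed_idl family_of_slices_def slice_def internal_idl_def)
qed

lemma family_of_slices_natural:
  assumes f: "f \<in> Arr C" and "I \<in> carrier (fib (internal_idl C L) (tgt C f))"
  shows "family_of_slices (src C f) (res (internal_idl C L) f I)
    = res (zed C (idl_presheaf C L)) f (family_of_slices (tgt C f) I)"
proof -
  have I: "I \<in> subpresheaves C L (tgt C f)"
    using assms(2) by (simp add: carrier_internal_idl[OF tgt_closed[OF f]])
  show ?thesis
    unfolding res_zed family_of_slices_def[of "src C f"]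
    using slice_pow_res[OF I f] cmp_arr_into(1)[OF f]
    by (intro restrict_ext) (simp add: internal_idl_def family_of_slices_def)
qed

theorem internal_idl_iso_zed: "presheaf_iso C (internal_idl C L) (zed C (idl_presheaf C L))"
  unfolding presheaf_iso_def
  using is_presheaf_internal_idl idl.is_presheaf_zed bij_family_of_slices
    order_emb_family_of_slices family_of_slices_natural
  by (intro conjI exI[of _ family_of_slices] ballI) auto

end


section \<open>The internal object of ideals\<close>

theorem corollary2p10:
  fixes C :: "('o, 'm) cat"
    and L :: "('o, 'm, 'x) presheaf"
  assumes "small_category C"
    and "has_weak_pullbacks C"
    and "jsl_presheaf C L"
  shows "presheaf_iso C (internal_idl C L) (zed C (idl_presheaf C L)) \<and>
    internal_suplattice C (zed C (idl_presheaf C L)) (zed_sigma C (idl_presheaf C L)) \<and>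
    ((\<forall>a \<in> Obj C. distributive_jsl (fib L a)) \<longrightarrow>
       internal_frame C (zed C (idl_presheaf C L)) (zed_sigma C (idl_presheaf C L)))"
proof (intro conjI impI)
  interpret presheaf_of_jsl C L
    using assms(1,3) by (simp add: presheaf_of_jsl_def presheaf_of_jsl_axioms_def)
  show "presheaf_iso C (internal_idl C L) (zed C (idl_presheaf C L))"
    by (rule internal_idl_iso_zed)
  show "internal_suplattice C (zed C (idl_presheaf C L)) (zed_sigma C (idl_presheaf C L))"
    by (rule idl.internal_suplattice_zed)
  assume "\<forall>a \<in> Obj C. distributive_jsl (fib L a)"
  then interpret frames: suplat_presheaf_of_frames C "idl_presheaf C L"
    by unfold_locales (simp add: idl_presheaf_def jsl.frame_idl[OF jsl_fib])
  show "internal_frame C (zed C (idl_presheaf C L)) (zed_sigma C (idl_presheaf C L))"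
    by (rule frames.internal_frame_zed)
qed

end
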